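(* The bilinear form $\langle\cdot,\cdot\rangle$ on the Russell skein module $R_n$ is nondegenerate and symmetric.
   Context: A diagram is a crossingless matching of the points $1,\ldots,2n$ on a horizontal line (arcs drawn below the line), each arc carrying at most one dot. $R_n$ is the $\mathbb{Z}$-module spanned by diagrams modulo the following relations, for $a<b<c<d$ and diagrams identical away from arcs ending at $a,b,c,d$ (a bar marks a dotted arc). Type I: $[\overline{ab},cd]+[ab,\overline{cd}]=[\overline{ad},bc]+[ad,\overline{bc}]$. Type II: $[\overline{ab},\overline{cd}]=[\overline{ad},\overline{bc}]$. Bilinear form $\langle\cdot,\cdot\rangle:R_n\otimes R_n\to\mathbb{Z}$. For diagrams $a,b$: rotate $b$ by 180 degrees, replace each of its dots by an X, and glue its endpoints to those of $a$ (so endpoint $j$ of $a$ is glued to endpoint $2n+1-j$ of $b$). The result is a collection of circles decorated with dots and X's; marks may slide along a circle but not past one another. $\langle a,b\rangle$ is the product over the circles of the following values: a circle with no marks has value $2$; a circle with the same number (at least one) of dots and X's, arranged alternately, has value $1$; any other circle has value $0$. The form is extended bilinearly; it is well defined on $R_n$. *)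

theory Defs
  imports "HOL-Algebra.Algebra" "HOL-Library.Disjoint_Sets" "HOL-Combinatorics.Cycles"
begin

definition crossingless_matching :: "nat \<Rightarrow> nat set set \<Rightarrow> bool" where
  "crossingless_matching n M \<longleftrightarrow>
     partition_on {1..2*n} M \<and> (\<forall>A\<in>M. card A = 2) \<and>
     \<not> (\<exists>a b c d. a < b \<and> b < c \<and> c < d \<and> {a, c} \<in> M \<and> {b, d} \<in> M)"

text \<open>A diagram is a pair of the set of its arcs and the set of those arcs that carry a dot.\<close>

type_synonym diagram = "nat set set \<times> nat set set"

definition diagrams :: "nat \<Rightarrow> diagram set" where
  "diagrams n = {(M, D). crossingless_matching n M \<and> D \<subseteq> M}"

text \<open>In the two families of relators, \<open>N\<close> consists of the arcs away from \<open>a, b, c, d\<close> and \<open>E\<close> of the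
  dotted ones among them. Since \<open>N\<close> together with two arcs on \<open>a, b, c, d\<close> is a partition of the
  points in two ways, \<open>N\<close> contains no arc ending at one of \<open>a, b, c, d\<close>.\<close>

definition exchange :: "nat \<Rightarrow> nat \<Rightarrow> nat \<Rightarrow> nat \<Rightarrow> nat \<Rightarrow> nat set set \<Rightarrow> nat set set \<Rightarrow> bool" where
  "exchange n a b c d N E \<longleftrightarrow>
     a < b \<and> b < c \<and> c < d \<and> E \<subseteq> N \<and>
     crossingless_matching n (N \<union> {{a, b}, {c, d}}) \<and>
     crossingless_matching n (N \<union> {{a, d}, {b, c}})"

definition type_I_relators :: "nat \<Rightarrow> (diagram \<Rightarrow>\<^sub>0 int) set" where
  "type_I_relators n =
     {  frag_of (N \<union> {{a, b}, {c, d}}, E \<union> {{a, b}})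
      + frag_of (N \<union> {{a, b}, {c, d}}, E \<union> {{c, d}})
      - (frag_of (N \<union> {{a, d}, {b, c}}, E \<union> {{a, d}})
       + frag_of (N \<union> {{a, d}, {b, c}}, E \<union> {{b, c}})) | a b c d N E. exchange n a b c d N E}"

definition type_II_relators :: "nat \<Rightarrow> (diagram \<Rightarrow>\<^sub>0 int) set" where
  "type_II_relators n =
     {  frag_of (N \<union> {{a, b}, {c, d}}, E \<union> {{a, b}, {c, d}})
      - frag_of (N \<union> {{a, d}, {b, c}}, E \<union> {{a, d}, {b, c}}) | a b c d N E. exchange n a b c d N E}"

definition skein_relations :: "nat \<Rightarrow> (diagram \<Rightarrow>\<^sub>0 int) set" where
  "skein_relations n =
     generate (free_Abelian_group (diagrams n)) (type_I_relators n \<union> type_II_relators n)"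

text \<open>The abelian group underlying the integer module \<open>R\<^sub>n\<close>; its elements are cosets, and its
  operation (written multiplicatively by the library) is addition of cosets.\<close>

definition russell_skein_module :: "nat \<Rightarrow> (diagram \<Rightarrow>\<^sub>0 int) set monoid" where
  "russell_skein_module n = free_Abelian_group (diagrams n) Mod skein_relations n"

definition skein_class :: "nat \<Rightarrow> (diagram \<Rightarrow>\<^sub>0 int) \<Rightarrow> (diagram \<Rightarrow>\<^sub>0 int) set" where
  "skein_class n f = skein_relations n #>\<^bsub>free_Abelian_group (diagrams n)\<^esub> f"

datatype mark = Dot | Cross

definition rotate_arcs :: "nat \<Rightarrow> nat set set \<Rightarrow> nat set set" where
  "rotate_arcs n M = (\<lambda>A. (\<lambda>j. 2*n + 1 - j) ` A) ` M"

definition partner :: "nat set set \<Rightarrow> nat \<Rightarrow> nat" where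
  "partner M p = (THE q. {p, q} \<in> M)"

text \<open>In the following, \<open>M\<close> is the set of arcs on one side of the line and \<open>M'\<close> the set of arcs on the
  other side. A circle is represented by the set of points of \<open>{1..2*n}\<close> through which it passes.\<close>

definition glued_circles :: "nat \<Rightarrow> nat set set \<Rightarrow> nat set set \<Rightarrow> nat set set" where
  "glued_circles n M M' = {1..2*n} // {(p, q). {p, q} \<in> M \<union> M'}\<^sup>*"

text \<open>The cyclic word of marks met when travelling once around the circle through \<open>p\<close>, starting at \<open>p\<close>
  along an arc of \<open>M\<close>. The points \<open>q\<close> below are those reached from \<open>p\<close> after an even number of arcs;
  each of them contributes the following arc of \<open>M\<close> and then the following arc of \<open>M'\<close>.\<close>

definition mark_word ::
  "nat set set \<Rightarrow> nat set set \<Rightarrow> nat set set \<Rightarrow> nat set set \<Rightarrow> nat \<Rightarrow> mark list" where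
  "mark_word M D M' D' p =
     concat (map (\<lambda>q. let r = partner M q; s = partner M' r
                      in (if {q, r} \<in> D then [Dot] else []) @ (if {r, s} \<in> D' then [Cross] else []))
                 (support (partner M' \<circ> partner M) p))"

definition cyclically_alternating :: "mark list \<Rightarrow> bool" where
  "cyclically_alternating w \<longleftrightarrow> (\<forall>i<length w. w ! i \<noteq> w ! (Suc i mod length w))"

definition circle_value :: "mark list \<Rightarrow> int" where
  "circle_value w =
     (if w = [] then 2
      else if count_list w Dot = count_list w Cross \<and> cyclically_alternating w then 1
      else 0)"

text \<open>\<open>circle_value\<close> is invariant under rotation and reversal of the word, so that starting at the
  smallest point of each circle is merely a convention.\<close>

definition diagram_pairing :: "nat \<Rightarrow> diagram \<Rightarrow> diagram \<Rightarrow> int" where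
  "diagram_pairing n a b =
     (let M = fst a; D = snd a; M' = rotate_arcs n (fst b); D' = rotate_arcs n (snd b)
      in \<Prod>C\<in>glued_circles n M M'. circle_value (mark_word M D M' D' (Min C)))"

definition free_form :: "nat \<Rightarrow> (diagram \<Rightarrow>\<^sub>0 int) \<Rightarrow> (diagram \<Rightarrow>\<^sub>0 int) \<Rightarrow> int" where
  "free_form n f g =
     (\<Sum>a\<in>Poly_Mapping.keys f. \<Sum>b\<in>Poly_Mapping.keys g.
        Poly_Mapping.lookup f a * Poly_Mapping.lookup g b * diagram_pairing n a b)"

text \<open>The common value of \<open>free_form\<close> on all representatives of two classes.\<close>

definition skein_form ::
  "nat \<Rightarrow> (diagram \<Rightarrow>\<^sub>0 int) set \<Rightarrow> (diagram \<Rightarrow>\<^sub>0 int) set \<Rightarrow> int" where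
  "skein_form n U V = (THE k. \<forall>f\<in>U. \<forall>g\<in>V. free_form n f g = k)"

definition symmetric_form_on :: "('a, 'b) monoid_scheme \<Rightarrow> ('a \<Rightarrow> 'a \<Rightarrow> int) \<Rightarrow> bool" where
  "symmetric_form_on G B \<longleftrightarrow> (\<forall>x\<in>carrier G. \<forall>y\<in>carrier G. B x y = B y x)"

text \<open>Nondegeneracy over the integers: both radicals vanish (as opposed to unimodularity, which
  would require the induced maps to the dual to be bijective).\<close>

definition nondegenerate_form_on :: "('a, 'b) monoid_scheme \<Rightarrow> ('a \<Rightarrow> 'a \<Rightarrow> int) \<Rightarrow> bool" where
  "nondegenerate_form_on G B \<longleftrightarrow>
     (\<forall>x\<in>carrier G. (\<forall>y\<in>carrier G. B x y = 0) \<longrightarrow> x = \<one>\<^bsub>G\<^esub>) \<and>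
     (\<forall>y\<in>carrier G. (\<forall>x\<in>carrier G. B x y = 0) \<longrightarrow> y = \<one>\<^bsub>G\<^esub>)"

end

theory Submission
  imports Defs
begin

text \<open>
  Attach to a diagram the polynomial \<open>\<Prod>(x\<^sub>a + x\<^sub>b)\<close> over its undotted arcs, and let \<open>S\<close> range over the
  monomials, i.e. sets of points: the coefficient at \<open>S\<close> is 1 if \<open>S\<close> contains exactly one end of every
  undotted arc and no end of a dotted one, and 0 otherwise. Around a single circle the number of sets
  compatible with both sides is the trace of a product of transfer matrices, a dot contributing the
  matrix unit \<open>E\<^sub>0\<^sub>1\<close> and an X contributing \<open>E\<^sub>1\<^sub>0\<close>; this trace is the value of the circle. Hence the pairing
  is the standard inner product of the polynomials, up to the rotation of the line. This gives
  symmetry at once, well-definedness because both relations are identities of polynomials, and, since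
  the inner product is positive definite and rotation permutes the diagrams, reduces nondegeneracy to
  the claim that every combination of diagrams with polynomial 0 follows from the relations. For that,
  the relations rewrite every diagram in terms of diagrams whose dotted arcs are not nested in any
  other arc, and the polynomials of these have pairwise distinct leading monomials.
\<close>

subsection \<open>The value of a circle as a trace\<close>

text \<open>\<open>path w s t\<close> holds iff the product of the matrix units of the marks in \<open>w\<close> has entry 1, rather
  than 0, at \<open>(s, t)\<close>.\<close>

fun path :: "mark list \<Rightarrow> bool \<Rightarrow> bool \<Rightarrow> bool" where
  "path [] s t \<longleftrightarrow> s = t"
| "path (Dot # w) s t \<longleftrightarrow> \<not> s \<and> path w True t"
| "path (Cross # w) s t \<longleftrightarrow> s \<and> path w False t"

lemma path_append: "path (u @ v) s t \<longleftrightarrow> (\<exists>r. path u s r \<and> path v r t)"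
proof (induction u arbitrary: s)
  case (Cons a u)
  then show ?case by (cases a) auto
qed auto

text \<open>A dot lifts the state from \<open>False\<close> to \<open>True\<close> and an X lowers
  it again, so the imbalance of the two counts is the net change of state.\<close>

lemma path_count:
  "path w s t \<Longrightarrow> count_list w Dot + of_bool s = count_list w Cross + (of_bool t :: nat)"
  by (induction w s t rule: path.induct) auto

text \<open>Every mark flips the state, so the initial state and the parity of a position determine
  the mark there.\<close>

lemma path_iff_nth:
  "path w s t \<longleftrightarrow> (\<forall>i<length w. w ! i = Dot \<longleftrightarrow> (s \<longleftrightarrow> odd i)) \<and> (t \<longleftrightarrow> (s \<longleftrightarrow> even (length w)))"
proof (induction w arbitrary: s)
  case (Cons a w)
  then show ?case
    by (cases a) (auto simp: All_less_Suc2)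
qed auto

text \<open>The first mark dictates the only possible initial state \<open>s\<close>. Returning to
  \<open>s\<close> means that alternation continues across the end of the word, which is the
  wrap-around in \<open>cyclically_alternating\<close>.\<close>

lemma closed_path_iff:
  assumes "w \<noteq> []"
  defines "s \<equiv> w ! 0 \<noteq> Dot"
  shows "path w s s \<longleftrightarrow> count_list w Dot = count_list w Cross \<and> cyclically_alternating w"
proof
  assume *: "path w s s"
  then have nth: "w ! i = Dot \<longleftrightarrow> (s \<longleftrightarrow> odd i)" if "i < length w" for i
    using that unfolding path_iff_nth by blast
  have ev: "even (length w)"
    using * unfolding path_iff_nth by blast
  have "w ! i \<noteq> w ! (Suc i mod length w)" if i: "i < length w" for i
  proof (cases "Suc i = length w")
    case True
    then have "Suc i mod length w = 0" "odd i"
      using ev by (simp, metis even_Suc)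
    moreover have "0 < length w"
      using le_less_trans[OF le0 i] .
    ultimately show ?thesis
      using nth[of i] nth[of 0] i by (metis even_zero)
  next
    case False
    then have "Suc i < length w"
      using i by simp
    then have "Suc i mod length w = Suc i"
      by simp
    then show ?thesis
      using nth[of i] nth[of "Suc i"] i \<open>Suc i < length w\<close> by auto
  qed
  then show "count_list w Dot = count_list w Cross \<and> cyclically_alternating w"
    using path_count[OF *] by (auto simp: cyclically_alternating_def)
next
  assume "count_list w Dot = count_list w Cross \<and> cyclically_alternating w"
  then have alt: "w ! i \<noteq> w ! (Suc i mod length w)" if "i < length w" for i
    using that by (auto simp: cyclically_alternating_def)
  have nth: "w ! i = Dot \<longleftrightarrow> (s \<longleftrightarrow> odd i)" if "i < length w" for i
    using that
  proof (induction i)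
    case (Suc i)
    then have "w ! i \<noteq> w ! Suc i"
      using alt[of i] by simp
    then show ?case
      using Suc by (cases "w ! i"; cases "w ! Suc i") auto
  qed (simp add: s_def)
  obtain k where k: "length w = Suc k"
    using assms(1) by (cases w) auto
  \<comment> \<open>At the last index the successor modulo the length is 0. This excludes odd
    length, including a single mark.\<close>
  then have "w ! k \<noteq> w ! 0"
    using alt[of k] by simp
  then have "(w ! k = Dot) \<noteq> (w ! 0 = Dot)"
    by (cases "w ! k"; cases "w ! 0") auto
  then have "even (length w)"
    using nth[of k] k s_def by auto
  then show "path w s s"
    using nth by (auto simp: path_iff_nth)
qed

text \<open>This is the trace of the product of matrix units: both states survive for the empty
  word, which gives the value 2, and at most one survives otherwise.\<close>

lemma card_closed_paths: "int (card {s. path w s s}) = circle_value w"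
proof (cases "w = []")
  case True
  then show ?thesis
    by (simp add: circle_value_def card_UNIV_bool)
next
  case False
  define s where "s \<longleftrightarrow> w ! 0 \<noteq> Dot"
  have "0 < length w"
    using False by simp
  then have "\<not> path w (\<not> s) (\<not> s)"
    unfolding path_iff_nth s_def by (metis even_zero)
  then have "path w t t \<longleftrightarrow> (t \<longleftrightarrow> s) \<and> path w s s" for t
    by (cases t; cases s) simp_all
  then have "{t. path w t t} = {t. (t \<longleftrightarrow> s) \<and> path w s s}"
    by (rule Collect_cong)
  also have "\<dots> = (if path w s s then {s} else {})"
    by (cases "path w s s") simp_all
  finally have *: "{t. path w t t} = (if path w s s then {s} else {})" .
  have "path w s s \<longleftrightarrow> count_list w Dot = count_list w Cross \<and> cyclically_alternating w"
    unfolding s_def by (rule closed_path_iff[OF False])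
  then show ?thesis
    unfolding * circle_value_def using False by simp
qed

section \<open>Arcs as constraints on the states of their ends\<close>

definition edge :: "bool \<Rightarrow> bool \<Rightarrow> bool \<Rightarrow> bool" where
  "edge marked x y \<longleftrightarrow> (if marked then \<not> x \<and> \<not> y else x \<noteq> y)"

lemma edge_unique: "edge b x y \<Longrightarrow> edge b x z \<Longrightarrow> y = z"
  by (auto simp: edge_def split: if_splits)

text \<open>An unmarked arc flips membership and a marked one forces both ends out of the set. Over
  two consecutive arcs two flips cancel, a mark on the first alone yields the step from
  \<open>False\<close> to \<open>True\<close>, and a mark on the second alone the step from
  \<open>True\<close> to \<open>False\<close>. Hence dots and X's act as different matrix units
  although both obey the same \<open>edge\<close>.\<close>

lemma path_arc_pair:
  "path ((if d then [Dot] else []) @ (if c then [Cross] else [])) s t \<longleftrightarrow>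
     (\<exists>y. edge d s y \<and> edge c y t)"
  by (auto simp: edge_def)

text \<open>The entry of a matrix product is expanded over the intermediate states:
  \<open>x k\<close> is the state after \<open>k\<close> arcs, and each arc pair contributes two of
  them.\<close>

lemma path_concat:
  "path (concat (map (\<lambda>i. (if mk (2*i) then [Dot] else []) @ (if mk (Suc (2*i)) then [Cross] else [])) [0..<m])) s t
    \<longleftrightarrow> (\<exists>x. x 0 = s \<and> x (2*m) = t \<and> (\<forall>k<2*m. edge (mk k) (x k) (x (Suc k))))"
    (is "path (?w m) s t \<longleftrightarrow> ?P m t")
proof (induction m arbitrary: t)
  case 0
  then show ?case by auto
next
  case (Suc m)
  have "path (?w (Suc m)) s t \<longleftrightarrow> (\<exists>r. ?P m r \<and> (\<exists>y. edge (mk (2*m)) r y \<and> edge (mk (Suc (2*m))) y t))"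
  proof -
    have "?w (Suc m) = ?w m @ ((if mk (2*m) then [Dot] else []) @ (if mk (Suc (2*m)) then [Cross] else []))"
      by simp
    then show ?thesis
      by (simp only: path_append[of "?w m"] Suc.IH path_arc_pair)
  qed
  also have "\<dots> \<longleftrightarrow> ?P (Suc m) t"
  proof
    assume "\<exists>r. ?P m r \<and> (\<exists>y. edge (mk (2*m)) r y \<and> edge (mk (Suc (2*m))) y t)"
    then obtain x y where x: "x 0 = s" "\<forall>k<2*m. edge (mk k) (x k) (x (Suc k))"
      and y: "edge (mk (2*m)) (x (2*m)) y" "edge (mk (Suc (2*m))) y t"
      by auto
    define x' where "x' = x(Suc (2*m) := y, Suc (Suc (2*m)) := t)"
    have "x' 0 = s" "x' (2 * Suc m) = t"
      using x by (auto simp: x'_def)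
    moreover have "edge (mk k) (x' k) (x' (Suc k))" if "k < 2 * Suc m" for k
    proof -
      have "k < 2*m \<or> k = 2*m \<or> k = Suc (2*m)"
        using that by auto
      then show ?thesis
        using x y by (auto simp: x'_def)
    qed
    ultimately show "?P (Suc m) t"
      by blast
  next
    assume "?P (Suc m) t"
    then obtain x where "x 0 = s" "x (2 * Suc m) = t" "\<forall>k<2*Suc m. edge (mk k) (x k) (x (Suc k))"
      by blast
    then show "\<exists>r. ?P m r \<and> (\<exists>y. edge (mk (2*m)) r y \<and> edge (mk (Suc (2*m))) y t)"
      by (intro exI[of _ "x (2*m)"] conjI exI[of _ x] exI[of _ "x (Suc (2*m))"]) auto
  qed
  finally show ?case .
qed

subsection \<open>Perfect matchings\<close>

text \<open>The part of \<open>crossingless_matching\<close> that counting along circles relies on,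
  stated over an arbitrary point set.\<close>

definition perfect_matching :: "'a set \<Rightarrow> 'a set set \<Rightarrow> bool" where
  "perfect_matching V M \<longleftrightarrow> partition_on V M \<and> (\<forall>A\<in>M. card A = 2)"

lemma crossingless_matching_perfect:
  "crossingless_matching n M \<Longrightarrow> perfect_matching {1..2*n} M"
  by (simp add: crossingless_matching_def perfect_matching_def)

lemma matching_arcE:
  assumes "perfect_matching V M" "A \<in> M"
  obtains u v where "A = {u, v}" "u \<noteq> v" "u \<in> V" "v \<in> V"
proof -
  have "card A = 2" "A \<subseteq> V"
    using assms by (auto simp: perfect_matching_def partition_on_def)
  then show ?thesis
    using that by (auto simp: card_2_iff)
qed

lemma matching_arc_eq:
  assumes "perfect_matching V M" "A \<in> M" "B \<in> M" "p \<in> A" "p \<in> B"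
  shows "A = B"
  using assms by (auto simp: perfect_matching_def partition_on_def disjoint_def)

lemma matching_mate_unique:
  assumes "perfect_matching V M" "{p, q} \<in> M" "{p, r} \<in> M"
  shows "q = r"
  using matching_arc_eq[OF assms, of p] by (auto simp: doubleton_eq_iff)

lemma matching_pair_neq:
  assumes "perfect_matching V M" "{p, q} \<in> M"
  shows "p \<noteq> q" "p \<in> V" "q \<in> V"
  using matching_arcE[OF assms] by (metis doubleton_eq_iff)+

lemma matching_mate_ex:
  assumes "perfect_matching V M" "p \<in> V"
  shows "\<exists>q. {p, q} \<in> M"
proof -
  obtain A where "A \<in> M" "p \<in> A"
    using assms by (auto simp: perfect_matching_def partition_on_def)
  moreover from this obtain u v where "A = {u, v}"
    using matching_arcE[OF assms(1)] by metis
  ultimately show ?thesis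
    by (metis insert_commute insertE singletonD)
qed

lemma partner_eqI:
  assumes "perfect_matching V M" "{p, q} \<in> M"
  shows "partner M p = q"
  unfolding partner_def
  using assms(2) by (rule the_equality) (rule matching_mate_unique[OF assms(1) _ assms(2)])

lemma partner:
  assumes "perfect_matching V M" "p \<in> V"
  shows partner_arc: "{p, partner M p} \<in> M"
    and partner_neq: "partner M p \<noteq> p"
    and partner_in: "partner M p \<in> V"
    and partner_partner: "partner M (partner M p) = p"
proof -
  obtain q where q: "{p, q} \<in> M"
    using matching_mate_ex[OF assms] by blast
  have eq: "partner M p = q" "partner M q = p"
    using partner_eqI[OF assms(1)] q by (auto simp: insert_commute)
  then show "{p, partner M p} \<in> M" "partner M p \<noteq> p" "partner M p \<in> V" "partner M (partner M p) = p"
    using q matching_pair_neq[OF assms(1) q] by auto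
qed

lemma partner_iff:
  assumes "perfect_matching V M"
  shows "{p, q} \<in> M \<longleftrightarrow> p \<in> V \<and> q = partner M p"
  using partner_arc[OF assms] partner_eqI[OF assms] matching_pair_neq[OF assms] by blast

text \<open>The sets \<open>S\<close> whose monomial occurs in the polynomial of \<open>a\<close>.
  Points outside all arcs are unconstrained, so the predicate also applies to the arcs of a single
  circle and to the common part \<open>N\<close> of an exchange.\<close>

definition transversal :: "'a set set \<times> 'a set set \<Rightarrow> 'a set \<Rightarrow> bool" where
  "transversal a S \<longleftrightarrow> (\<forall>A\<in>fst a. card (S \<inter> A) = of_bool (A \<notin> snd a))"

lemma card_inter_arc:
  assumes "u \<noteq> v"
  shows "card (S \<inter> {u, v}) = of_bool (\<not> marked) \<longleftrightarrow> edge marked (u \<in> S) (v \<in> S)"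
  using assms by (auto simp: edge_def Int_insert_right)

subsection \<open>Circles of a pair of matchings\<close>

locale matching_pair =
  fixes V :: "nat set" and M M' :: "nat set set"
  assumes finite_V: "finite V"
    and M: "perfect_matching V M" and M': "perfect_matching V M'"
begin

fun walk :: "nat \<Rightarrow> nat \<Rightarrow> nat" where
  "walk p 0 = p"
| "walk p (Suc k) = partner (if even k then M else M') (walk p k)"

lemma walk_in: "p \<in> V \<Longrightarrow> walk p k \<in> V"
  by (induction k) (auto simp: partner_in[OF M] partner_in[OF M'])

lemma walk_back:
  "p \<in> V \<Longrightarrow> partner (if even k then M else M') (walk p (Suc k)) = walk p k"
  using walk_in[of p k] by (auto simp: partner_partner[OF M] partner_partner[OF M'])

text \<open>If two points an odd number of steps apart coincided, stepping inwards from both along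
  arcs of the same matching would give a coincidence two steps closer. At distance 1 an arc would
  have equal ends.\<close>

lemma walk_parity_neq: "p \<in> V \<Longrightarrow> walk p a \<noteq> walk p (a + 2*k + 1)"
proof (induction k arbitrary: a)
  case 0
  then show ?case
    using walk_in[of p a] partner_neq[OF M, of "walk p a"] partner_neq[OF M', of "walk p a"] by auto
next
  case (Suc k)
  show ?case
  proof
    assume eq: "walk p a = walk p (a + 2 * Suc k + 1)"
    have "walk p (Suc a) = partner (if even a then M else M') (walk p (Suc (a + 2 * Suc k)))"
      using eq by simp
    also have "\<dots> = walk p (Suc a + 2*k + 1)"
      using walk_back[OF Suc.prems, of "a + 2 * Suc k"] by simp
    finally show False
      using Suc by blast
  qed
qed

definition turn :: "nat \<Rightarrow> nat" where
  "turn = partner M' \<circ> partner M"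

lemma walk_even: "walk p (2*i) = (turn ^^ i) p"
  by (induction i) (auto simp: turn_def)

lemma turn_in: "p \<in> V \<Longrightarrow> turn p \<in> V"
  by (simp add: turn_def partner_in[OF M] partner_in[OF M'])

lemma turn_inj: "inj_on turn V"
  by (rule inj_on_inverseI[where g = "partner M \<circ> partner M'"])
    (simp add: turn_def partner_in[OF M] partner_partner[OF M] partner_partner[OF M'])

lemma turn_funpow_in: "p \<in> V \<Longrightarrow> (turn ^^ i) p \<in> V"
  by (induction i) (auto simp: turn_in)

text \<open>Injectivity of \<open>turn\<close> is available only on \<open>V\<close>, so the
  cancellation of powers is carried out there.\<close>

lemma turn_funpow_cancel:
  "p \<in> V \<Longrightarrow> (turn ^^ i) p = (turn ^^ (i + j)) p \<Longrightarrow> (turn ^^ j) p = p"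
proof (induction i)
  case (Suc i)
  then have "turn ((turn ^^ i) p) = turn ((turn ^^ (i + j)) p)"
    by simp
  then have "(turn ^^ i) p = (turn ^^ (i + j)) p"
    using inj_onD[OF turn_inj] turn_funpow_in Suc.prems(1) by blast
  then show ?case
    using Suc by blast
qed simp

text \<open>By finiteness of \<open>V\<close> two powers of \<open>turn\<close> agree at
  \<open>p\<close>, and cancellation turns this into a return to \<open>p\<close>.\<close>

lemma least_power_turn:
  assumes "p \<in> V"
  shows "(turn ^^ least_power turn p) p = p" "least_power turn p > 0"
proof -
  have "finite (range (\<lambda>i. (turn ^^ i) p))"
    using turn_funpow_in[OF assms] by (intro finite_subset[OF _ finite_V]) auto
  then have "\<not> inj (\<lambda>i. (turn ^^ i) p)"
    using finite_imageD infinite_UNIV_nat by blast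
  then obtain i j where "i < j" "(turn ^^ i) p = (turn ^^ j) p"
    by (meson linorder_injI)
  then have "(turn ^^ (j - i)) p = p" "0 < j - i"
    using turn_funpow_cancel[OF assms, of i "j - i"] by auto
  then show "(turn ^^ least_power turn p) p = p" "least_power turn p > 0"
    by (rule least_powerI)+
qed

lemma turn_funpow_inj:
  assumes "p \<in> V"
  shows "inj_on (\<lambda>i. (turn ^^ i) p) {..<least_power turn p}"
proof (rule linorder_inj_onI)
  fix i j assume ij: "i < j" "i \<in> {..<least_power turn p}" "j \<in> {..<least_power turn p}"
  show "(turn ^^ i) p \<noteq> (turn ^^ j) p"
  proof
    assume "(turn ^^ i) p = (turn ^^ j) p"
    then have "(turn ^^ (j - i)) p = p"
      using turn_funpow_cancel[OF assms, of i "j - i"] ij by simp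
    then have "least_power turn p \<le> j - i"
      using ij by (intro least_power_le) auto
    then show False
      using ij by auto
  qed
qed auto

definition circle_length :: "nat \<Rightarrow> nat" where
  "circle_length p = 2 * least_power turn p"

lemma walk_closes: "p \<in> V \<Longrightarrow> walk p (circle_length p) = p"
  unfolding circle_length_def walk_even by (rule least_power_turn)

text \<open>Positions of different parity are separated by \<open>walk_parity_neq\<close>. Even
  positions form an orbit of \<open>turn\<close>, and two odd ones reduce to even ones by going back
  one step.\<close>

lemma walk_inj:
  assumes "p \<in> V"
  shows "inj_on (walk p) {..<circle_length p}"
proof (rule linorder_inj_onI)
  fix a b assume ab: "a < b" "a \<in> {..<circle_length p}" "b \<in> {..<circle_length p}"
  show "walk p a \<noteq> walk p b"
  proof (cases "even (b - a)")
    case False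
    then obtain k where "b - a = 2*k + 1"
      by (elim oddE)
    then have "b = a + 2*k + 1"
      using ab by simp
    then show ?thesis
      using walk_parity_neq[OF assms] by blast
  next
    case True
    show ?thesis
    proof (cases "even a")
      case True
      have "even b"
        using True \<open>even (b - a)\<close> ab(1) by presburger
      then obtain i j where "a = 2*i" "b = 2*j"
        using True by (elim evenE)
      then show ?thesis
        using ab inj_onD[OF turn_funpow_inj[OF assms], of i j] by (auto simp: walk_even circle_length_def)
    next
      case False
      then have "odd b"
        using \<open>even (b - a)\<close> ab(1) by presburger
      then obtain i j where ij: "a = Suc (2*i)" "b = Suc (2*j)"
        using False by (elim oddE) simp
      show ?thesis
      proof
        assume "walk p a = walk p b"
        then have "walk p (2*i) = walk p (2*j)"
          using walk_back[OF assms, of "2*i"] walk_back[OF assms, of "2*j"] ij by simp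
        then show False
          using ab ij inj_onD[OF turn_funpow_inj[OF assms], of i j] by (auto simp: walk_even circle_length_def)
      qed
    qed
  qed
qed auto

definition circle :: "nat \<Rightarrow> nat set" where
  "circle p = walk p ` {..<circle_length p}"

lemma circle_length_pos: "p \<in> V \<Longrightarrow> circle_length p > 0"
  using least_power_turn by (simp add: circle_length_def)

lemma walk_in_circle:
  assumes "p \<in> V" "k \<le> circle_length p"
  shows "walk p k \<in> circle p"
proof (cases "k = circle_length p")
  case True
  then have "walk p k = walk p 0"
    using walk_closes[OF assms(1)] by simp
  then show ?thesis
    using circle_length_pos[OF assms(1)] unfolding circle_def by blast
qed (use assms in \<open>auto simp: circle_def\<close>)

lemma circle_subset: "p \<in> V \<Longrightarrow> circle p \<subseteq> V"
  by (auto simp: circle_def walk_in)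

lemma mem_circle: "p \<in> V \<Longrightarrow> p \<in> circle p"
  using walk_in_circle[of p 0] by simp

text \<open>Of the two arcs at \<open>walk p k\<close>, one is the step leaving it and the other the
  step entering it; the parity of \<open>k\<close> tells which belongs to which matching.\<close>

lemma circle_arcE:
  assumes "p \<in> V" "q \<in> circle p"
  obtains k where "k < circle_length p" "even k = e"
    "{q, partner (if e then M else M') q} = {walk p k, walk p (Suc k)}"
proof -
  obtain k where k: "k < circle_length p" "q = walk p k"
    using assms(2) by (auto simp: circle_def)
  show thesis
  proof (cases "even k = e")
    case True
    then show ?thesis
      using that[of k] k by auto
  next
    case False
    show ?thesis
    proof (cases k)
      \<comment> \<open>At the starting point the entering step is the last one of the whole round.
        Its index \<open>Suc (2*m)\<close> is odd, so it is an arc of \<open>M'\<close>.\<close>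
      case 0
      obtain m where "least_power turn p = Suc m"
        using least_power_turn(2)[OF assms(1)] gr0_implies_Suc by blast
      then have l: "circle_length p = Suc (Suc (2*m))"
        by (simp add: circle_length_def)
      then have "partner M' p = walk p (Suc (2*m))" "p = walk p (Suc (Suc (2*m)))"
        using walk_back[OF assms(1), of "Suc (2*m)"] walk_closes[OF assms(1)] by (simp_all del: walk.simps)
      then have "{q, partner (if e then M else M') q} = {walk p (Suc (2*m)), walk p (Suc (Suc (2*m)))}"
        using 0 k(2) False by (auto simp del: walk.simps(2))
      then show ?thesis
        using that[of "Suc (2*m)"] l False 0 by (simp del: walk.simps)
    next
      case (Suc j)
      then have "partner (if e then M else M') q = walk p j"
        using walk_back[OF assms(1), of j] k(2) False by (auto simp del: walk.simps)
      then show ?thesis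
        using that[of j] k False Suc by (auto simp del: walk.simps)
    qed
  qed
qed

lemma partner_circle:
  assumes "p \<in> V" "q \<in> circle p"
  shows "partner M q \<in> circle p" "partner M' q \<in> circle p"
proof -
  have "partner (if e then M else M') q \<in> circle p" for e
  proof -
    obtain k where k: "k < circle_length p"
      "{q, partner (if e then M else M') q} = {walk p k, walk p (Suc k)}"
      using circle_arcE[OF assms, of e] .
    then have "partner (if e then M else M') q \<in> {walk p k, walk p (Suc k)}"
      by blast
    then show ?thesis
      using walk_in_circle[OF assms(1), of k] walk_in_circle[OF assms(1), of "Suc k"] k(1) by auto
  qed
  from this[of True] this[of False] show "partner M q \<in> circle p" "partner M' q \<in> circle p"
    by simp_all
qed

text \<open>This identifies the equivalence classes behind \<open>glued_circles\<close> with the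
  circles traced by walks: a circle is closed under both partners, and every walk stays in one
  class.\<close>

lemma class_eq_circle:
  assumes "p \<in> V"
  shows "{(p, q). {p, q} \<in> M \<union> M'}\<^sup>* `` {p} = circle p" (is "?R\<^sup>* `` _ = _")
proof
  have "q \<in> circle p" if "(p, q) \<in> ?R\<^sup>*" for q
    using that
  proof (induction rule: rtrancl_induct)
    case base
    then show ?case using mem_circle[OF assms] .
  next
    case (step q r)
    then show ?case
      using partner_circle[OF assms] by (auto simp: partner_iff[OF M] partner_iff[OF M'])
  qed
  then show "?R\<^sup>* `` {p} \<subseteq> circle p"
    by auto
  have "(p, walk p k) \<in> ?R\<^sup>*" for k
  proof (induction k)
    case (Suc k)
    have "(walk p k, walk p (Suc k)) \<in> ?R"
      using partner_arc[OF M walk_in[OF assms, of k]] partner_arc[OF M' walk_in[OF assms, of k]] by auto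
    then show ?case
      using Suc by (rule rtrancl_into_rtrancl[rotated])
  qed auto
  then show "circle p \<subseteq> ?R\<^sup>* `` {p}"
    by (auto simp: circle_def)
qed

section \<open>Transversals restricted to one circle\<close>

definition consistent :: "nat set set \<Rightarrow> nat set set \<Rightarrow> nat set \<Rightarrow> nat set \<Rightarrow> bool" where
  "consistent D D' C T \<longleftrightarrow>
     T \<subseteq> C \<and> transversal ({A \<in> M. A \<subseteq> C}, D) T \<and> transversal ({A \<in> M'. A \<subseteq> C}, D') T"

definition step_marked :: "nat set set \<Rightarrow> nat set set \<Rightarrow> nat \<Rightarrow> nat \<Rightarrow> bool" where
  "step_marked D D' p k \<longleftrightarrow> {walk p k, walk p (Suc k)} \<in> (if even k then D else D')"

lemma walk_arc: "p \<in> V \<Longrightarrow> {walk p k, walk p (Suc k)} \<in> (if even k then M else M')"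
  using partner_arc[OF M walk_in, of p k] partner_arc[OF M' walk_in, of p k] by simp

lemma walk_step_neq: "p \<in> V \<Longrightarrow> walk p k \<noteq> walk p (Suc k)"
  using walk_parity_neq[of p k 0] by simp

lemma card_inter_step:
  assumes "p \<in> V"
  shows "card (T \<inter> {walk p k, walk p (Suc k)})
      = of_bool ({walk p k, walk p (Suc k)} \<notin> (if even k then D else D'))
    \<longleftrightarrow> edge (step_marked D D' p k) (walk p k \<in> T) (walk p (Suc k) \<in> T)"
  unfolding step_marked_def by (rule card_inter_arc[OF walk_step_neq[OF assms]])

text \<open>The arcs inside the circle are exactly the steps of the walk, so transversality becomes
  a chain of \<open>edge\<close> constraints on consecutive states.\<close>

lemma consistent_circle_iff:
  assumes p: "p \<in> V"
  shows "consistent D D' (circle p) T \<longleftrightarrow>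
    T \<subseteq> circle p \<and>
    (\<forall>k<circle_length p. edge (step_marked D D' p k) (walk p k \<in> T) (walk p (Suc k) \<in> T))"
proof safe
  assume *: "consistent D D' (circle p) T"
  fix k assume k: "k < circle_length p"
  have "{walk p k, walk p (Suc k)} \<subseteq> circle p"
    using walk_in_circle[OF p, of k] walk_in_circle[OF p, of "Suc k"] k by simp
  then have "card (T \<inter> {walk p k, walk p (Suc k)})
      = of_bool ({walk p k, walk p (Suc k)} \<notin> (if even k then D else D'))"
    using * walk_arc[OF p, of k] by (cases "even k") (auto simp: consistent_def transversal_def simp del: walk.simps)
  then show "edge (step_marked D D' p k) (walk p k \<in> T) (walk p (Suc k) \<in> T)"
    using card_inter_step[OF p] by blast
next
  assume T: "T \<subseteq> circle p"
    and *: "\<forall>k<circle_length p. edge (step_marked D D' p k) (walk p k \<in> T) (walk p (Suc k) \<in> T)"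
  have main: "card (T \<inter> A) = of_bool (A \<notin> (if e then D else D'))"
    if A: "A \<in> (if e then M else M')" "A \<subseteq> circle p" for A e
  proof -
    have pm: "perfect_matching V (if e then M else M')"
      using M M' by simp
    obtain q r where qr: "A = {q, r}"
      using matching_arcE[OF pm A(1)] by metis
    then have "r = partner (if e then M else M') q"
      using partner_iff[OF pm, of q r] A(1) by metis
    moreover have "q \<in> circle p"
      using qr A(2) by simp
    ultimately obtain k where "k < circle_length p" "even k = e" "A = {walk p k, walk p (Suc k)}"
      using circle_arcE[OF p, of q e] qr by metis
    then show ?thesis
      using * card_inter_step[OF p, of T k D D'] by (simp del: walk.simps)
  qed
  show "consistent D D' (circle p) T"
    unfolding consistent_def transversal_def using T main[of _ True] main[of _ False] by simp
next
  fix x assume "consistent D D' (circle p) T" "x \<in> T"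
  then show "x \<in> circle p"
    by (auto simp: consistent_def)
qed

text \<open>The \<open>support\<close> of \<open>turn\<close> lists the even positions of the walk,
  so each entry contributes the marks of the steps \<open>2*i\<close> and
  \<open>Suc (2*i)\<close>.\<close>

lemma mark_word_eq:
  "mark_word M D M' D' p = concat (map (\<lambda>i.
      (if step_marked D D' p (2*i) then [Dot] else []) @
      (if step_marked D D' p (Suc (2*i)) then [Cross] else [])) [0..<least_power turn p])"
proof -
  have "partner M' \<circ> partner M = turn"
    by (simp add: turn_def)
  then show ?thesis
    by (simp add: mark_word_def step_marked_def Let_def walk_even o_def)
qed

text \<open>Each constraint determines the next state, so a consistent set is known once it is known
  whether it contains \<open>p\<close>; the admissible answers are the states with a closed
  path.\<close>

lemma card_consistent_circle:
  assumes p: "p \<in> V"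
  shows "int (card {T. consistent D D' (circle p) T}) = circle_value (mark_word M D M' D' p)"
proof -
  let ?w = "mark_word M D M' D' p"
  let ?mk = "step_marked D D' p"
  have path: "path ?w s s \<longleftrightarrow> (\<exists>x. x 0 = s \<and> x (circle_length p) = s \<and>
      (\<forall>k<circle_length p. edge (?mk k) (x k) (x (Suc k))))" for s
    unfolding mark_word_eq path_concat circle_length_def ..
  have "bij_betw (\<lambda>T. p \<in> T) {T. consistent D D' (circle p) T} {s. path ?w s s}"
    unfolding bij_betw_def
  proof
    show "inj_on (\<lambda>T. p \<in> T) {T. consistent D D' (circle p) T}"
    proof (rule inj_onI)
      fix T T' assume T: "T \<in> {T. consistent D D' (circle p) T}" "T' \<in> {T. consistent D D' (circle p) T}"
        and eq: "(p \<in> T) = (p \<in> T')"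
      have same: "k < circle_length p \<Longrightarrow> walk p k \<in> T \<longleftrightarrow> walk p k \<in> T'" for k
      proof (induction k)
        case (Suc k)
        then have k: "k < circle_length p"
          by simp
        have "edge (?mk k) (walk p k \<in> T) (walk p (Suc k) \<in> T)"
          "edge (?mk k) (walk p k \<in> T') (walk p (Suc k) \<in> T')"
          using T k by (auto simp: consistent_circle_iff[OF p] simp del: walk.simps)
        then show ?case
          unfolding Suc.IH[OF k] by (rule edge_unique)
      qed (use eq in simp)
      have "T \<subseteq> circle p" "T' \<subseteq> circle p"
        using T by (auto simp: consistent_def)
      then show "T = T'"
        using same unfolding circle_def by blast
    qed
    show "(\<lambda>T. p \<in> T) ` {T. consistent D D' (circle p) T} = {s. path ?w s s}"
    proof (intro equalityI subsetI)
      fix s assume "s \<in> (\<lambda>T. p \<in> T) ` {T. consistent D D' (circle p) T}"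
      then obtain T where T: "consistent D D' (circle p) T" "s = (p \<in> T)"
        by blast
      have "path ?w s s"
        unfolding path
        by (rule exI[of _ "\<lambda>k. walk p k \<in> T"])
          (use T walk_closes[OF p] in \<open>simp add: consistent_circle_iff[OF p] del: walk.simps(2)\<close>)
      then show "s \<in> {s. path ?w s s}" ..
    next
      fix s assume "s \<in> {s. path ?w s s}"
      then obtain x where x: "x 0 = s" "x (circle_length p) = s"
        "\<And>k. k < circle_length p \<Longrightarrow> edge (?mk k) (x k) (x (Suc k))"
        unfolding path mem_Collect_eq by blast
      \<comment> \<open>The set is read off from the states along one round. Injectivity of the walk
        makes the states independent of each other, and \<open>x (circle_length p) = s\<close> takes
        care of the closing step.\<close>
      define T where "T = walk p ` {k. k < circle_length p \<and> x k}"
      have T: "walk p k \<in> T \<longleftrightarrow> x k" if "k < circle_length p" for k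
        using that inj_onD[OF walk_inj[OF p]] by (auto simp: T_def)
      have T0: "p \<in> T \<longleftrightarrow> s"
        using T[of 0] circle_length_pos[OF p] x(1) by simp
      have "walk p k \<in> T \<longleftrightarrow> x k" if "k \<le> circle_length p" for k
        using that T[of k] T0 walk_closes[OF p] x(2) by (cases "k = circle_length p") auto
      then have "consistent D D' (circle p) T"
        unfolding consistent_circle_iff[OF p] using x(3)
        by (auto simp: T_def circle_def simp del: walk.simps)
      then show "s \<in> (\<lambda>T. p \<in> T) ` {T. consistent D D' (circle p) T}"
        using T0 by blast
    qed
  qed
  then show ?thesis
    using bij_betw_same_card card_closed_paths by metis
qed

section \<open>Assembling all circles\<close>

definition circles :: "nat set set" where
  "circles = circle ` V"

lemma finite_circles: "finite circles"
  by (simp add: circles_def finite_V)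

lemma circles_disjoint:
  assumes "B \<in> circles" "C \<in> circles" "x \<in> B" "x \<in> C"
  shows "B = C"
proof -
  define R where "R = {(p, q). {p, q} \<in> M \<union> M'}"
  have "sym R"
    by (auto simp: R_def sym_def insert_commute)
  then have "equiv UNIV (R\<^sup>*)"
    by (intro equivI) (auto simp: refl_on_def intro: sym_rtrancl trans_rtrancl)
  moreover have "B \<in> UNIV // R\<^sup>*" "C \<in> UNIV // R\<^sup>*"
    using assms(1,2) class_eq_circle by (auto simp: circles_def R_def quotient_def)
  ultimately show ?thesis
    using quotient_disj assms(3,4) by blast
qed

text \<open>Any point of a circle generates it; the smallest one is the base point used in
  \<open>diagram_pairing\<close>.\<close>

lemma circles_Min:
  assumes "C \<in> circles"
  shows "Min C \<in> V" "circle (Min C) = C"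
proof -
  obtain p where p: "p \<in> V" "C = circle p"
    using assms by (auto simp: circles_def)
  then have "finite C" "C \<noteq> {}" "C \<subseteq> V"
    using circle_subset[OF p(1)] mem_circle[OF p(1)] finite_subset[OF _ finite_V] by auto
  then have "Min C \<in> C"
    by simp
  then show "Min C \<in> V"
    using \<open>C \<subseteq> V\<close> by blast
  then show "circle (Min C) = C"
    using circles_disjoint[of "circle (Min C)" C "Min C"] assms mem_circle \<open>Min C \<in> C\<close>
    by (auto simp: circles_def)
qed

lemma Union_circles: "\<Union>circles = V"
  using circle_subset mem_circle by (auto simp: circles_def)

lemma arc_in_circle:
  assumes "A \<in> M \<or> A \<in> M'"
  shows "\<exists>C\<in>circles. A \<subseteq> C"
proof -
  obtain N where N: "N = M \<or> N = M'" "A \<in> N"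
    using assms by blast
  then have pm: "perfect_matching V N"
    using M M' by auto
  obtain u v where uv: "A = {u, v}" "u \<in> V"
    using matching_arcE[OF pm N(2)] by metis
  then have "v = partner N u"
    using partner_iff[OF pm] N(2) by blast
  then have "A \<subseteq> circle u"
    using uv N(1) mem_circle[OF uv(2)] partner_circle[OF uv(2) mem_circle[OF uv(2)]] by auto
  then show ?thesis
    using uv(2) by (auto simp: circles_def)
qed

text \<open>Every arc lies in one circle, so a common transversal amounts to an independent choice
  of a consistent subset of each circle, and the counts multiply.\<close>

lemma card_transversals:
  "int (card {S. S \<subseteq> V \<and> transversal (M, D) S \<and> transversal (M', D') S})
     = (\<Prod>C\<in>circles. circle_value (mark_word M D M' D' (Min C)))"
proof -
  let ?X = "{S. S \<subseteq> V \<and> transversal (M, D) S \<and> transversal (M', D') S}"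
  let ?Y = "PiE circles (\<lambda>C. {T. consistent D D' C T})"
  have inter_arc: "S \<inter> C \<inter> A = S \<inter> A" if "A \<subseteq> C" for S C A :: "nat set"
    using that by blast
  have part: "(\<Union>B\<in>circles. g B) \<inter> C = g C" if "g \<in> ?Y" "C \<in> circles" for g C
  proof -
    have "g B \<subseteq> B" if "B \<in> circles" for B
      using \<open>g \<in> ?Y\<close> that by (auto simp: PiE_def Pi_def consistent_def)
    then have "B = C" if "B \<in> circles" "x \<in> g B" "x \<in> C" for B x
      using circles_disjoint[OF that(1) \<open>C \<in> circles\<close>, of x] that by blast
    moreover have "g C \<subseteq> C"
      using \<open>\<And>B. B \<in> circles \<Longrightarrow> g B \<subseteq> B\<close> that(2) .
    ultimately show ?thesis
      using that(2) by blast
  qed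
  have "bij_betw (\<lambda>S. \<lambda>C\<in>circles. S \<inter> C) ?X ?Y"
  proof (rule bij_betw_byWitness[where f' = "\<lambda>g. \<Union>C\<in>circles. g C"])
    show "\<forall>S\<in>?X. (\<Union>C\<in>circles. (\<lambda>C\<in>circles. S \<inter> C) C) = S"
    proof
      fix S assume "S \<in> ?X"
      then have "S \<inter> \<Union>circles = S"
        unfolding Union_circles by blast
      moreover have "(\<Union>C\<in>circles. (\<lambda>C\<in>circles. S \<inter> C) C) = (\<Union>C\<in>circles. S \<inter> C)"
        by (rule SUP_cong) simp_all
      moreover have "\<dots> = S \<inter> \<Union>circles"
        by blast
      ultimately show "(\<Union>C\<in>circles. (\<lambda>C\<in>circles. S \<inter> C) C) = S"
        by simp
    qed
    show "\<forall>g\<in>?Y. (\<lambda>C\<in>circles. (\<Union>B\<in>circles. g B) \<inter> C) = g"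
    proof
      fix g assume g: "g \<in> ?Y"
      have "(\<lambda>C\<in>circles. (\<Union>B\<in>circles. g B) \<inter> C) = restrict g circles"
        by (rule restrict_ext) (rule part[OF g])
      then show "(\<lambda>C\<in>circles. (\<Union>B\<in>circles. g B) \<inter> C) = g"
        using PiE_restrict[OF g] by simp
    qed
    show "(\<lambda>S. \<lambda>C\<in>circles. S \<inter> C) ` ?X \<subseteq> ?Y"
    proof (rule image_subsetI)
      fix S assume "S \<in> ?X"
      then have "consistent D D' C (S \<inter> C)" for C
        by (simp add: consistent_def transversal_def inter_arc)
      then show "(\<lambda>C\<in>circles. S \<inter> C) \<in> ?Y"
        by (simp add: restrict_PiE_iff)
    qed
    show "(\<lambda>g. \<Union>C\<in>circles. g C) ` ?Y \<subseteq> ?X"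
    proof (rule image_subsetI)
      fix g assume g: "g \<in> ?Y"
      let ?S = "\<Union>C\<in>circles. g C"
      have gC: "consistent D D' C (g C)" if "C \<in> circles" for C
        using g that by (auto simp: PiE_def Pi_def)
      have "?S \<subseteq> V"
        using gC Union_circles by (auto simp: consistent_def)
      moreover have "card (?S \<inter> A) = of_bool (A \<notin> D)" if A: "A \<in> M" for A
      proof -
        obtain C where C: "C \<in> circles" "A \<subseteq> C"
          using arc_in_circle A by blast
        then have "?S \<inter> A = g C \<inter> A"
          using part[OF g C(1)] by blast
        then show ?thesis
          using gC[OF C(1)] C(2) A by (simp add: consistent_def transversal_def)
      qed
      moreover have "card (?S \<inter> A) = of_bool (A \<notin> D')" if A: "A \<in> M'" for A
      proof -
        obtain C where C: "C \<in> circles" "A \<subseteq> C"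
          using arc_in_circle A by blast
        then have "?S \<inter> A = g C \<inter> A"
          using part[OF g C(1)] by blast
        then show ?thesis
          using gC[OF C(1)] C(2) A by (simp add: consistent_def transversal_def)
      qed
      ultimately show "?S \<in> ?X"
        by (simp add: transversal_def)
    qed
  qed
  then have "card ?X = card ?Y"
    by (rule bij_betw_same_card)
  also have "\<dots> = (\<Prod>C\<in>circles. card {T. consistent D D' C T})"
    by (rule card_PiE[OF finite_circles])
  also have "int \<dots> = (\<Prod>C\<in>circles. circle_value (mark_word M D M' D' (Min C)))"
    unfolding of_nat_prod
  proof (rule prod.cong[OF refl])
    fix C assume "C \<in> circles"
    then show "int (card {T. consistent D D' C T}) = circle_value (mark_word M D M' D' (Min C))"
      using card_consistent_circle[of "Min C" D D'] circles_Min by simp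
  qed
  finally show ?thesis .
qed

end

section \<open>The pairing of diagrams as a count of common transversals\<close>

lemma glued_circles_eq:
  assumes "matching_pair {1..2*n} M M'"
  shows "glued_circles n M M' = matching_pair.circles {1..2*n} M M'"
proof -
  interpret matching_pair "{1..2*n}" M M'
    by fact
  show ?thesis
    unfolding glued_circles_def circles_def quotient_def UNION_singleton_eq_range
    by (rule image_cong[OF refl class_eq_circle])
qed

lemma perfect_matching_image:
  assumes "perfect_matching V M" "inj_on f V"
  shows "perfect_matching (f ` V) ((`) f ` M)"
proof -
  have "partition_on V M"
    using assms by (simp add: perfect_matching_def)
  then have "{} \<notin> M" "\<And>A. A \<in> M \<Longrightarrow> A \<subseteq> V"
    by (auto simp: partition_on_def)
  then have "(`) f ` M - {{}} = (`) f ` M"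
    by auto
  moreover have "card (f ` A) = 2" if "A \<in> M" for A
    using assms that \<open>A \<in> M \<Longrightarrow> A \<subseteq> V\<close> by (metis card_image inj_on_subset perfect_matching_def)
  ultimately show ?thesis
    using partition_on_inj_image[OF \<open>partition_on V M\<close> assms(2)] by (auto simp: perfect_matching_def)
qed

lemma image_reflection: "(\<lambda>j. 2*n + 1 - j) ` {1..2*n} = {1..2*n::nat}"
proof -
  have "x \<in> (\<lambda>j. 2*n + 1 - j) ` {1..2*n}" if "x \<in> {1..2*n}" for x
    using that by (intro image_eqI[of _ _ "2*n + 1 - x"]) auto
  then show ?thesis
    by auto
qed

lemma inj_on_reflection: "inj_on (\<lambda>j. 2*n + 1 - j) {1..2*n::nat}"
  by (auto simp: inj_on_def)

definition rotate_diagram :: "nat \<Rightarrow> diagram \<Rightarrow> diagram" where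
  "rotate_diagram n a = (rotate_arcs n (fst a), rotate_arcs n (snd a))"

text \<open>After rotation both sides are matchings of the same points, and the arcs with an X are
  the dotted arcs of \<open>rotate_diagram n b\<close>.\<close>

lemma diagram_pairing_eq_card:
  assumes "a \<in> diagrams n" "b \<in> diagrams n"
  shows "diagram_pairing n a b
    = int (card {S. S \<subseteq> {1..2*n} \<and> transversal a S \<and> transversal (rotate_diagram n b) S})"
proof -
  have "perfect_matching {1..2*n} (fst a)" "perfect_matching {1..2*n} (fst b)"
    using assms crossingless_matching_perfect by (auto simp: diagrams_def simp del: One_nat_def)
  moreover from this(2) have "perfect_matching {1..2*n} (rotate_arcs n (fst b))"
    using perfect_matching_image[OF _ inj_on_reflection] unfolding rotate_arcs_def image_reflection by blast
  ultimately interpret matching_pair "{1..2*n}" "fst a" "rotate_arcs n (fst b)"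
    by unfold_locales auto
  show ?thesis
    using card_transversals[of "snd a" "rotate_arcs n (snd b)"]
    by (simp add: diagram_pairing_def Let_def rotate_diagram_def glued_circles_eq[OF matching_pair_axioms]
        del: One_nat_def)
qed

subsection \<open>Rotation\<close>

abbreviation reflect :: "nat \<Rightarrow> nat set \<Rightarrow> nat set" where
  "reflect n S \<equiv> (\<lambda>j. 2*n + 1 - j) ` S"

lemma reflect_in: "S \<subseteq> {1..2*n} \<Longrightarrow> reflect n S \<subseteq> {1..2*n}"
  using image_mono[of S "{1..2*n}" "\<lambda>j. 2*n + 1 - j"] unfolding image_reflection .

text \<open>The bound on \<open>S\<close> keeps the subtraction of natural numbers from being
  truncated.\<close>

lemma reflect_reflect:
  assumes "S \<subseteq> {1..2*n}"
  shows "reflect n (reflect n S) = S"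
proof -
  have "2*n + 1 - (2*n + 1 - j) = j" if "j \<in> S" for j
    using assms that by auto
  then show ?thesis
    by (simp add: image_image)
qed

lemma arc_subset: "perfect_matching V M \<Longrightarrow> A \<in> M \<Longrightarrow> A \<subseteq> V"
  by (auto simp: perfect_matching_def partition_on_def)

lemma rotate_arcs_iff:
  assumes "\<And>A. A \<in> M \<Longrightarrow> A \<subseteq> {1..2*n}" "B \<subseteq> {1..2*n}"
  shows "B \<in> rotate_arcs n M \<longleftrightarrow> reflect n B \<in> M"
proof
  assume "B \<in> rotate_arcs n M"
  then obtain A where "A \<in> M" "B = reflect n A"
    by (auto simp: rotate_arcs_def)
  then show "reflect n B \<in> M"
    using reflect_reflect[OF assms(1)] by metis
next
  assume "reflect n B \<in> M"
  then have "reflect n (reflect n B) \<in> rotate_arcs n M"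
    unfolding rotate_arcs_def by (rule imageI)
  then show "B \<in> rotate_arcs n M"
    unfolding reflect_reflect[OF assms(2)] .
qed

lemma diagram_matching: "a \<in> diagrams n \<Longrightarrow> perfect_matching {1..2*n} (fst a)"
  using crossingless_matching_perfect by (auto simp: diagrams_def simp del: One_nat_def)

lemma diagram_arc_subset: "a \<in> diagrams n \<Longrightarrow> A \<in> fst a \<Longrightarrow> A \<subseteq> {1..2*n}"
  using arc_subset[OF diagram_matching] .

lemma diagram_dotted_subset: "a \<in> diagrams n \<Longrightarrow> A \<in> snd a \<Longrightarrow> A \<subseteq> {1..2*n}"
proof -
  assume "a \<in> diagrams n" "A \<in> snd a"
  moreover from this have "A \<in> fst a"
    by (auto simp: diagrams_def)
  ultimately show ?thesis
    using diagram_arc_subset by blast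
qed

text \<open>Reflection is injective on the points, so it can be moved from the arcs to the set
  without changing the sizes of intersections.\<close>

lemma transversal_rotate:
  assumes "a \<in> diagrams n" "S \<subseteq> {1..2*n}"
  shows "transversal (rotate_diagram n a) S \<longleftrightarrow> transversal a (reflect n S)"
proof -
  have "card (S \<inter> reflect n A) = card (reflect n S \<inter> A)"
    and "reflect n A \<in> rotate_arcs n (snd a) \<longleftrightarrow> A \<in> snd a" if A: "A \<in> fst a" for A
  proof -
    have A': "A \<subseteq> {1..2*n}"
      using diagram_arc_subset[OF assms(1) A] .
    have "reflect n (reflect n S \<inter> A) = reflect n (reflect n S) \<inter> reflect n A"
      by (rule inj_on_image_Int[OF inj_on_reflection reflect_in[OF assms(2)] A'])
    then have "reflect n (reflect n S \<inter> A) = S \<inter> reflect n A"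
      unfolding reflect_reflect[OF assms(2)] .
    moreover have "card (reflect n (reflect n S \<inter> A)) = card (reflect n S \<inter> A)"
      using A' by (intro card_image inj_on_subset[OF inj_on_reflection]) blast
    ultimately show "card (S \<inter> reflect n A) = card (reflect n S \<inter> A)"
      by metis
    show "reflect n A \<in> rotate_arcs n (snd a) \<longleftrightarrow> A \<in> snd a"
      using rotate_arcs_iff[OF diagram_dotted_subset[OF assms(1)] reflect_in[OF A']]
      unfolding reflect_reflect[OF A'] .
  qed
  then show ?thesis
    by (auto simp: transversal_def rotate_diagram_def rotate_arcs_def[of n "fst a"])
qed

text \<open>Reflection reverses the order of the points, and the pattern of two crossing arcs is its
  own mirror image.\<close>

lemma rotate_diagram_in:
  assumes "a \<in> diagrams n"
  shows "rotate_diagram n a \<in> diagrams n"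
proof -
  have cm: "crossingless_matching n (fst a)" and sub: "snd a \<subseteq> fst a"
    using assms by (auto simp: diagrams_def)
  have pm: "perfect_matching {1..2*n} (rotate_arcs n (fst a))"
    using perfect_matching_image[OF diagram_matching[OF assms] inj_on_reflection]
    unfolding rotate_arcs_def image_reflection .
  have False
    if "p < q" "q < r" "r < s" "{p, r} \<in> rotate_arcs n (fst a)" "{q, s} \<in> rotate_arcs n (fst a)" for p q r s
  proof -
    let ?r = "\<lambda>j. 2*n + 1 - j"
    have in_V: "{p, r} \<subseteq> {1..2*n}" "{q, s} \<subseteq> {1..2*n}"
      using that arc_subset[OF pm] by blast+
    have "{?r p, ?r r} \<in> fst a" "{?r q, ?r s} \<in> fst a"
      using rotate_arcs_iff[OF diagram_arc_subset[OF assms] in_V(1)]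
        rotate_arcs_iff[OF diagram_arc_subset[OF assms] in_V(2)] that(4,5) by auto
    then have "{?r s, ?r q} \<in> fst a" "{?r r, ?r p} \<in> fst a"
      by (simp_all add: insert_commute)
    moreover have "?r s < ?r r" "?r r < ?r q" "?r q < ?r p"
      using in_V that(1-3) by auto
    ultimately show False
      using cm unfolding crossingless_matching_def by blast
  qed
  then have "crossingless_matching n (rotate_arcs n (fst a))"
    using pm unfolding crossingless_matching_def perfect_matching_def by blast
  moreover have "rotate_arcs n (snd a) \<subseteq> rotate_arcs n (fst a)"
    using sub by (auto simp: rotate_arcs_def)
  ultimately show ?thesis
    by (simp add: diagrams_def rotate_diagram_def)
qed

lemma finite_diagrams: "finite (diagrams n)"
proof (rule finite_subset)
  show "diagrams n \<subseteq> Pow (Pow {1..2*n}) \<times> Pow (Pow {1..2*n})"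
    using diagram_arc_subset diagram_dotted_subset by fastforce
qed simp

subsection \<open>Coefficients and the bilinear form\<close>

text \<open>The coefficient at the monomial \<open>S\<close> of the polynomial of \<open>f\<close>.
  The sum runs over all diagrams rather than the keys of \<open>f\<close>, so that additivity is
  immediate.\<close>

definition coeff :: "nat \<Rightarrow> (diagram \<Rightarrow>\<^sub>0 int) \<Rightarrow> nat set \<Rightarrow> int" where
  "coeff n f S = (\<Sum>a\<in>diagrams n. Poly_Mapping.lookup f a * of_bool (transversal a S))"

lemma coeff_0 [simp]: "coeff n 0 S = 0"
  by (simp add: coeff_def)

lemma coeff_add [simp]: "coeff n (f + g) S = coeff n f S + coeff n g S"
  by (simp add: coeff_def lookup_add distrib_right sum.distrib)

lemma coeff_uminus [simp]: "coeff n (- f) S = - coeff n f S"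
  by (simp add: coeff_def sum_negf)

lemma coeff_diff [simp]: "coeff n (f - g) S = coeff n f S - coeff n g S"
  by (simp add: coeff_def lookup_minus left_diff_distrib sum_subtractf)

lemma coeff_frag_of: "a \<in> diagrams n \<Longrightarrow> coeff n (frag_of a) S = of_bool (transversal a S)"
  by (simp add: coeff_def finite_diagrams if_distrib[where f = "\<lambda>x. x * _"] cong: if_cong)

lemma diagram_pairing_eq_sum:
  assumes "a \<in> diagrams n" "b \<in> diagrams n"
  shows "diagram_pairing n a b
    = (\<Sum>S\<in>Pow {1..2*n}. of_bool (transversal a S) * of_bool (transversal b (reflect n S)))"
proof -
  have "{S. S \<subseteq> {1..2*n} \<and> transversal a S \<and> transversal (rotate_diagram n b) S}
      = {S \<in> Pow {1..2*n}. transversal a S \<and> transversal b (reflect n S)}"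
    using transversal_rotate[OF assms(2)] by blast
  then have "diagram_pairing n a b
      = (\<Sum>S\<in>{S \<in> Pow {1..2*n}. transversal a S \<and> transversal b (reflect n S)}. 1)"
    unfolding diagram_pairing_eq_card[OF assms] by simp
  also have "\<dots> = (\<Sum>S\<in>Pow {1..2*n}. if transversal a S \<and> transversal b (reflect n S) then 1 else 0)"
    by (rule sum.inter_filter) simp
  also have "\<dots> = (\<Sum>S\<in>Pow {1..2*n}. of_bool (transversal a S) * of_bool (transversal b (reflect n S)))"
    by (rule sum.cong) simp_all
  finally show ?thesis .
qed

text \<open>The form factors through the coefficients: the pairing of two diagrams is a sum over
  \<open>S\<close> of products, and exchanging the sums collects the coefficients of
  \<open>f\<close> and \<open>g\<close>.\<close>

lemma free_form_eq_sum:
  assumes "Poly_Mapping.keys f \<subseteq> diagrams n" "Poly_Mapping.keys g \<subseteq> diagrams n"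
  shows "free_form n f g = (\<Sum>S\<in>Pow {1..2*n}. coeff n f S * coeff n g (reflect n S))"
proof -
  let ?l = Poly_Mapping.lookup
  have inner: "(\<Sum>b\<in>Poly_Mapping.keys g. ?l f a * ?l g b * diagram_pairing n a b)
      = (\<Sum>b\<in>diagrams n. ?l f a * ?l g b * diagram_pairing n a b)" for a
    by (rule sum.mono_neutral_left[OF finite_diagrams assms(2)]) (simp add: in_keys_iff)
  have "free_form n f g = (\<Sum>a\<in>diagrams n. \<Sum>b\<in>diagrams n. ?l f a * ?l g b * diagram_pairing n a b)"
    unfolding free_form_def inner
    by (rule sum.mono_neutral_left[OF finite_diagrams assms(1)]) (simp add: in_keys_iff)
  also have "\<dots> = (\<Sum>a\<in>diagrams n. \<Sum>b\<in>diagrams n. \<Sum>S\<in>Pow {1..2*n}.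
      (?l f a * of_bool (transversal a S)) * (?l g b * of_bool (transversal b (reflect n S))))"
  proof (intro sum.cong refl)
    fix a b assume ab: "a \<in> diagrams n" "b \<in> diagrams n"
    show "?l f a * ?l g b * diagram_pairing n a b = (\<Sum>S\<in>Pow {1..2*n}.
        (?l f a * of_bool (transversal a S)) * (?l g b * of_bool (transversal b (reflect n S))))"
      unfolding diagram_pairing_eq_sum[OF ab] sum_distrib_left by (simp only: mult_ac)
  qed
  also have "\<dots> = (\<Sum>a\<in>diagrams n. \<Sum>S\<in>Pow {1..2*n}. \<Sum>b\<in>diagrams n.
      (?l f a * of_bool (transversal a S)) * (?l g b * of_bool (transversal b (reflect n S))))"
    by (intro sum.cong refl sum.swap)
  also have "\<dots> = (\<Sum>S\<in>Pow {1..2*n}. \<Sum>a\<in>diagrams n. \<Sum>b\<in>diagrams n.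
      (?l f a * of_bool (transversal a S)) * (?l g b * of_bool (transversal b (reflect n S))))"
    by (rule sum.swap)
  also have "\<dots> = (\<Sum>S\<in>Pow {1..2*n}. coeff n f S * coeff n g (reflect n S))"
    by (simp only: coeff_def sum_product)
  finally show ?thesis .
qed

text \<open>The substitution of \<open>reflect n S\<close> for \<open>S\<close>, an involution,
  exchanges the two factors.\<close>

lemma free_form_commute:
  assumes "Poly_Mapping.keys f \<subseteq> diagrams n" "Poly_Mapping.keys g \<subseteq> diagrams n"
  shows "free_form n f g = free_form n g f"
  unfolding free_form_eq_sum[OF assms] free_form_eq_sum[OF assms(2,1)]
proof (rule sum.reindex_bij_witness[where i = "reflect n" and j = "reflect n"])
  fix S assume "S \<in> Pow {1..2*n}"
  then have S: "S \<subseteq> {1..2*n}"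
    by simp
  show "reflect n (reflect n S) = S" "reflect n (reflect n S) = S"
    by (rule reflect_reflect[OF S])+
  show "reflect n S \<in> Pow {1..2*n}" "reflect n S \<in> Pow {1..2*n}"
    using reflect_in[OF S] by blast+
  show "coeff n g (reflect n S) * coeff n f (reflect n (reflect n S)) = coeff n f S * coeff n g (reflect n S)"
    unfolding reflect_reflect[OF S] by (rule mult.commute)
qed

text \<open>Pairing with the rotated diagrams turns the form into the standard inner product of coefficients,
  which is positive definite.\<close>

lemma coeff_eq_0_if_radical:
  assumes keys: "Poly_Mapping.keys f \<subseteq> diagrams n"
    and radical: "\<And>a. a \<in> diagrams n \<Longrightarrow> free_form n f (frag_of a) = 0"
    and "S \<subseteq> {1..2*n}"
  shows "coeff n f S = 0"
proof -
  \<comment> \<open>Testing against the rotated diagram cancels the reflection in the form.\<close>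
  have orth: "(\<Sum>S\<in>Pow {1..2*n}. coeff n f S * of_bool (transversal a S)) = 0" if a: "a \<in> diagrams n" for a
  proof -
    have "coeff n (frag_of (rotate_diagram n a)) (reflect n S) = of_bool (transversal a S)"
      if "S \<in> Pow {1..2*n}" for S
    proof -
      have S: "S \<subseteq> {1..2*n}"
        using that by simp
      show ?thesis
        unfolding coeff_frag_of[OF rotate_diagram_in[OF a]] transversal_rotate[OF a reflect_in[OF S]]
          reflect_reflect[OF S] ..
    qed
    then show ?thesis
      using radical[OF rotate_diagram_in[OF a]] free_form_eq_sum[OF keys, of "frag_of (rotate_diagram n a)"]
        rotate_diagram_in[OF a] by (simp del: One_nat_def)
  qed
  \<comment> \<open>One factor of the sum of squares is expanded over diagrams, which leaves a
    combination of the sums that vanish by \<open>orth\<close>.\<close>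
  have "(\<Sum>S\<in>Pow {1..2*n}. coeff n f S * coeff n f S)
      = (\<Sum>S\<in>Pow {1..2*n}. \<Sum>a\<in>diagrams n. Poly_Mapping.lookup f a * (coeff n f S * of_bool (transversal a S)))"
    by (intro sum.cong refl) (subst (2) coeff_def, simp add: sum_distrib_left mult_ac)
  also have "\<dots> = (\<Sum>a\<in>diagrams n. Poly_Mapping.lookup f a * (\<Sum>S\<in>Pow {1..2*n}. coeff n f S * of_bool (transversal a S)))"
    unfolding sum_distrib_left by (rule sum.swap)
  also have "\<dots> = 0"
    by (intro sum.neutral ballI) (simp only: orth mult_zero_right)
  finally have "\<forall>S\<in>Pow {1..2*n}. coeff n f S * coeff n f S = 0"
    by (subst (asm) sum_nonneg_eq_0_iff) simp_all
  then show ?thesis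
    using assms(3) by simp
qed

subsection \<open>The skein relations\<close>

lemma transversal_add_arcs:
  assumes "u \<noteq> v" "w \<noteq> x" "{u, v} \<notin> N" "{w, x} \<notin> N" "E \<subseteq> N" "Z \<subseteq> {{u, v}, {w, x}}"
  shows "transversal (N \<union> {{u, v}, {w, x}}, E \<union> Z) S \<longleftrightarrow>
    transversal (N, E) S \<and> edge ({u, v} \<in> Z) (u \<in> S) (v \<in> S) \<and> edge ({w, x} \<in> Z) (w \<in> S) (x \<in> S)"
proof -
  have "A \<notin> E \<union> Z \<longleftrightarrow> A \<notin> E" if "A \<in> N" for A
    using that assms by blast
  moreover have "{u, v} \<in> E \<union> Z \<longleftrightarrow> {u, v} \<in> Z" "{w, x} \<in> E \<union> Z \<longleftrightarrow> {w, x} \<in> Z"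
    using assms by blast+
  ultimately have "transversal (N \<union> {{u, v}, {w, x}}, E \<union> Z) S \<longleftrightarrow> transversal (N, E) S \<and>
      card (S \<inter> {u, v}) = of_bool ({u, v} \<notin> Z) \<and> card (S \<inter> {w, x}) = of_bool ({w, x} \<notin> Z)"
    unfolding transversal_def fst_conv snd_conv ball_Un by auto
  then show ?thesis
    unfolding card_inter_arc[OF assms(1)] card_inter_arc[OF assms(2)] .
qed

text \<open>Each of these arcs shares exactly one end with an arc of the other matching, which also
  contains \<open>N\<close>.\<close>

lemma exchange_arcs_notin:
  assumes "exchange n a b c d N E"
  shows "{a, b} \<notin> N" "{c, d} \<notin> N" "{a, d} \<notin> N" "{b, c} \<notin> N"
proof -
  have pm: "perfect_matching {1..2*n} (N \<union> {{a, b}, {c, d}})" "perfect_matching {1..2*n} (N \<union> {{a, d}, {b, c}})"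
    and lt: "a < b" "b < c" "c < d"
    using assms crossingless_matching_perfect unfolding exchange_def by blast+
  show "{a, b} \<notin> N"
    using matching_mate_unique[OF pm(2), of a b d] lt by auto
  show "{a, d} \<notin> N"
    using matching_mate_unique[OF pm(1), of a b d] lt by auto
  show "{c, d} \<notin> N"
    using matching_mate_unique[OF pm(2), of d c a] lt by (auto simp: insert_commute)
  show "{b, c} \<notin> N"
    using matching_mate_unique[OF pm(1), of b c a] lt by (auto simp: insert_commute)
qed

lemma exchange_diagrams:
  assumes "exchange n a b c d N E"
  shows "Z \<subseteq> {{a, b}, {c, d}} \<Longrightarrow> (N \<union> {{a, b}, {c, d}}, E \<union> Z) \<in> diagrams n"
    and "Y \<subseteq> {{a, d}, {b, c}} \<Longrightarrow> (N \<union> {{a, d}, {b, c}}, E \<union> Y) \<in> diagrams n"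
  using assms by (auto simp: exchange_def diagrams_def)

lemma coeff_exchange:
  assumes "exchange n a b c d N E"
  shows "Z \<subseteq> {{a, b}, {c, d}} \<Longrightarrow> coeff n (frag_of (N \<union> {{a, b}, {c, d}}, E \<union> Z)) S
      = of_bool (transversal (N, E) S \<and> edge ({a, b} \<in> Z) (a \<in> S) (b \<in> S) \<and> edge ({c, d} \<in> Z) (c \<in> S) (d \<in> S))"
    and "Y \<subseteq> {{a, d}, {b, c}} \<Longrightarrow> coeff n (frag_of (N \<union> {{a, d}, {b, c}}, E \<union> Y)) S
      = of_bool (transversal (N, E) S \<and> edge ({a, d} \<in> Y) (a \<in> S) (d \<in> S) \<and> edge ({b, c} \<in> Y) (b \<in> S) (c \<in> S))"
proof -
  have *: "a \<noteq> b" "c \<noteq> d" "a \<noteq> d" "b \<noteq> c" "E \<subseteq> N"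
    using assms by (auto simp: exchange_def)
  note notin = exchange_arcs_notin[OF assms]
  show "coeff n (frag_of (N \<union> {{a, b}, {c, d}}, E \<union> Z)) S
      = of_bool (transversal (N, E) S \<and> edge ({a, b} \<in> Z) (a \<in> S) (b \<in> S) \<and> edge ({c, d} \<in> Z) (c \<in> S) (d \<in> S))"
    if "Z \<subseteq> {{a, b}, {c, d}}"
    using transversal_add_arcs[OF *(1,2) notin(1,2) *(5) that]
    by (simp only: coeff_frag_of[OF exchange_diagrams(1)[OF assms that]])
  show "coeff n (frag_of (N \<union> {{a, d}, {b, c}}, E \<union> Y)) S
      = of_bool (transversal (N, E) S \<and> edge ({a, d} \<in> Y) (a \<in> S) (d \<in> S) \<and> edge ({b, c} \<in> Y) (b \<in> S) (c \<in> S))"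
    if "Y \<subseteq> {{a, d}, {b, c}}"
    using transversal_add_arcs[OF *(3,4) notin(3,4) *(5) that]
    by (simp only: coeff_frag_of[OF exchange_diagrams(2)[OF assms that]])
qed

text \<open>Up to the common factor from \<open>N\<close> and \<open>E\<close>, type I is the
  identity (x_c + x_d) + (x_a + x_b) = (x_b + x_c) + (x_a + x_d) and type II is 1 = 1.\<close>

lemma relator_props:
  assumes "f \<in> type_I_relators n \<union> type_II_relators n"
  shows "Poly_Mapping.keys f \<subseteq> diagrams n" "coeff n f S = 0"
proof -
  have "Poly_Mapping.keys f \<subseteq> diagrams n \<and> coeff n f S = 0"
    using assms
  proof
    assume "f \<in> type_I_relators n"
    then obtain a b c d N E where ex: "exchange n a b c d N E"
      and f: "f = frag_of (N \<union> {{a, b}, {c, d}}, E \<union> {{a, b}})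
        + frag_of (N \<union> {{a, b}, {c, d}}, E \<union> {{c, d}})
        - (frag_of (N \<union> {{a, d}, {b, c}}, E \<union> {{a, d}})
         + frag_of (N \<union> {{a, d}, {b, c}}, E \<union> {{b, c}}))"
      unfolding type_I_relators_def by blast
    have neq: "{a, b} \<noteq> {c, d}" "{a, d} \<noteq> {b, c}"
      using ex by (auto simp: exchange_def doubleton_eq_iff)
    have "Poly_Mapping.keys f \<subseteq> diagrams n"
      unfolding f by (intro order.trans[OF keys_diff] order.trans[OF keys_add] Un_least)
        (unfold keys_frag_of, simp_all only: insert_subset empty_subsetI simp_thms exchange_diagrams[OF ex]
          subset_insertI insertI1 insertI2)
    moreover have
      "coeff n (frag_of (N \<union> {{a, b}, {c, d}}, E \<union> {{a, b}})) S
        = of_bool (transversal (N, E) S \<and> (a \<notin> S \<and> b \<notin> S) \<and> ((c \<in> S) \<noteq> (d \<in> S)))"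
      "coeff n (frag_of (N \<union> {{a, b}, {c, d}}, E \<union> {{c, d}})) S
        = of_bool (transversal (N, E) S \<and> ((a \<in> S) \<noteq> (b \<in> S)) \<and> (c \<notin> S \<and> d \<notin> S))"
      "coeff n (frag_of (N \<union> {{a, d}, {b, c}}, E \<union> {{a, d}})) S
        = of_bool (transversal (N, E) S \<and> (a \<notin> S \<and> d \<notin> S) \<and> ((b \<in> S) \<noteq> (c \<in> S)))"
      "coeff n (frag_of (N \<union> {{a, d}, {b, c}}, E \<union> {{b, c}})) S
        = of_bool (transversal (N, E) S \<and> ((a \<in> S) \<noteq> (d \<in> S)) \<and> (b \<notin> S \<and> c \<notin> S))"
      using coeff_exchange(1)[OF ex, of "{{a, b}}" S] coeff_exchange(1)[OF ex, of "{{c, d}}" S]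
        coeff_exchange(2)[OF ex, of "{{a, d}}" S] coeff_exchange(2)[OF ex, of "{{b, c}}" S] neq neq[symmetric]
      by (simp_all only: edge_def insert_iff empty_iff simp_thms if_True if_False
        subset_insertI insertI1 insertI2 insert_subset empty_subsetI)
    then have "coeff n f S = 0"
      unfolding f coeff_add coeff_diff by (auto simp: of_bool_def)
    ultimately show ?thesis
      by simp
  next
    assume "f \<in> type_II_relators n"
    then obtain a b c d N E where ex: "exchange n a b c d N E"
      and f: "f = frag_of (N \<union> {{a, b}, {c, d}}, E \<union> {{a, b}, {c, d}})
        - frag_of (N \<union> {{a, d}, {b, c}}, E \<union> {{a, d}, {b, c}})"
      unfolding type_II_relators_def by blast
    have "Poly_Mapping.keys f \<subseteq> diagrams n"
      unfolding f by (intro order.trans[OF keys_diff] Un_least)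
        (unfold keys_frag_of, simp_all only: insert_subset empty_subsetI simp_thms exchange_diagrams[OF ex] order.refl)
    moreover have "coeff n f S = 0"
      unfolding f coeff_diff coeff_exchange[OF ex order.refl] by (auto simp: edge_def)
    ultimately show ?thesis
      by simp
  qed
  then show "Poly_Mapping.keys f \<subseteq> diagrams n" "coeff n f S = 0"
    by auto
qed

lemma subgroup_skein_relations: "subgroup (skein_relations n) (free_Abelian_group (diagrams n))"
  unfolding skein_relations_def
  by (intro group.generate_is_subgroup group_free_Abelian_group) (use relator_props(1) in auto)

lemma skein_relations_keys: "h \<in> skein_relations n \<Longrightarrow> Poly_Mapping.keys h \<subseteq> diagrams n"
  using subgroup.mem_carrier[OF subgroup_skein_relations] by simp

lemma coeff_skein_relations:
  assumes "h \<in> skein_relations n"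
  shows "coeff n h S = 0"
  using assms unfolding skein_relations_def
proof (induction rule: generate.induct)
  case (inv h)
  then show ?case
    using relator_props[OF inv] by simp
qed (use relator_props(2) in simp_all)

lemma skein_relations_add: "f \<in> skein_relations n \<Longrightarrow> g \<in> skein_relations n \<Longrightarrow> f + g \<in> skein_relations n"
  using subgroup.m_closed[OF subgroup_skein_relations] by simp

lemma skein_relations_uminus: "f \<in> skein_relations n \<Longrightarrow> - f \<in> skein_relations n"
  using subgroup.m_inv_closed[OF subgroup_skein_relations] skein_relations_keys by fastforce

lemma skein_relations_0: "0 \<in> skein_relations n"
  using subgroup.one_closed[OF subgroup_skein_relations] by simp

lemma mem_skein_class_iff: "x \<in> skein_class n f \<longleftrightarrow> x - f \<in> skein_relations n"
proof -
  have "x \<in> skein_class n f \<longleftrightarrow> (\<exists>h\<in>skein_relations n. x = h + f)"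
    by (auto simp: skein_class_def r_coset_def)
  also have "\<dots> \<longleftrightarrow> x - f \<in> skein_relations n"
    by (auto intro: bexI[of _ "x - f"])
  finally show ?thesis .
qed

text \<open>Representatives of one class have the same coefficients, on which alone
  \<open>free_form\<close> depends, so the description in \<open>skein_form\<close> singles out one
  value.\<close>

lemma skein_form_class:
  assumes "Poly_Mapping.keys f \<subseteq> diagrams n" "Poly_Mapping.keys g \<subseteq> diagrams n"
  shows "skein_form n (skein_class n f) (skein_class n g) = free_form n f g"
proof -
  have cls: "Poly_Mapping.keys x \<subseteq> diagrams n \<and> coeff n x = coeff n u"
    if "Poly_Mapping.keys u \<subseteq> diagrams n" "x \<in> skein_class n u" for x u
  proof -
    have h: "x - u \<in> skein_relations n"
      using that(2) by (simp add: mem_skein_class_iff)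
    have "Poly_Mapping.keys ((x - u) + u) \<subseteq> diagrams n"
      using keys_add[of "x - u" u] skein_relations_keys[OF h] that(1) by blast
    then show ?thesis
      using coeff_skein_relations[OF h] by (auto simp: fun_eq_iff)
  qed
  have const: "free_form n x y = free_form n f g" if "x \<in> skein_class n f" "y \<in> skein_class n g" for x y
    using cls[OF assms(1) that(1)] cls[OF assms(2) that(2)] assms
    by (simp add: free_form_eq_sum del: One_nat_def)
  have mem: "f \<in> skein_class n f" "g \<in> skein_class n g"
    by (simp_all add: mem_skein_class_iff skein_relations_0)
  show ?thesis
    unfolding skein_form_def
  proof (rule the_equality)
    show "\<forall>x\<in>skein_class n f. \<forall>y\<in>skein_class n g. free_form n x y = free_form n f g"
      using const by blast
    show "k = free_form n f g" if "\<forall>x\<in>skein_class n f. \<forall>y\<in>skein_class n g. free_form n x y = k" for k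
      using that mem by simp
  qed
qed

subsection \<open>Reduction to standard diagrams\<close>

lemma matching_arc_lessE:
  assumes "perfect_matching V M" "A \<in> M"
  obtains u v :: "'a :: linorder" where "A = {u, v}" "u < v" "u \<in> V" "v \<in> V"
  using matching_arcE[OF assms] by (metis insert_commute linorder_neqE)

lemma diagram_noncrossing:
  assumes "z \<in> diagrams n" "{p, r} \<in> fst z" "{q, s} \<in> fst z" "p < q" "q < r" "r < s"
  shows False
  using assms unfolding diagrams_def crossingless_matching_def by auto

lemma diagram_mate_unique:
  assumes "z \<in> diagrams n" "{p, q} \<in> fst z" "{p, r} \<in> fst z"
  shows "q = r"
  using matching_mate_unique[OF diagram_matching[OF assms(1)] assms(2,3)] .

lemma diagram_dotted_arc: "z \<in> diagrams n \<Longrightarrow> A \<in> snd z \<Longrightarrow> A \<in> fst z"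
  by (auto simp: diagrams_def)

definition standard :: "diagram \<Rightarrow> bool" where
  "standard z \<longleftrightarrow> (\<forall>a b c d. a < b \<longrightarrow> b < c \<longrightarrow> c < d \<longrightarrow> {a, d} \<in> fst z \<longrightarrow> {b, c} \<notin> snd z)"

text \<open>Twice the total length of the arcs, with dotted arcs counted only once. Un-nesting two
  arcs shortens them, and moving a dot from an inner to an outer arc discounts the longer one, so
  all rewriting steps decrease this number.\<close>

definition complexity :: "diagram \<Rightarrow> nat" where
  "complexity z = (\<Sum>A\<in>fst z. (if A \<in> snd z then 1 else 2) * (Max A - Min A))"

lemma complexity_add_arcs:
  assumes "finite N" "E \<subseteq> N" "Z \<subseteq> {{u, v}, {w, x}}" "{u, v} \<notin> N" "{w, x} \<notin> N" "{u, v} \<noteq> {w, x}"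
    and "u < v" "w < x"
  shows "complexity (N \<union> {{u, v}, {w, x}}, E \<union> Z) = complexity (N, E)
    + (if {u, v} \<in> Z then 1 else 2) * (v - u) + (if {w, x} \<in> Z then 1 else 2) * (x - w)"
proof -
  let ?f = "\<lambda>F A. (if A \<in> F then 1 else 2) * (Max A - Min A)"
  have "(\<Sum>A\<in>N. ?f (E \<union> Z) A) = (\<Sum>A\<in>N. ?f E A)"
    by (rule sum.cong) (use assms in auto)
  moreover have "N \<union> {{u, v}, {w, x}} = insert {u, v} (insert {w, x} N)"
    by blast
  moreover have "{u, v} \<in> E \<union> Z \<longleftrightarrow> {u, v} \<in> Z" "{w, x} \<in> E \<union> Z \<longleftrightarrow> {w, x} \<in> Z"
    using assms by blast+
  moreover have "Max {u, v} - Min {u, v} = v - u" "Max {w, x} - Min {w, x} = x - w"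
    using assms by simp_all
  ultimately show ?thesis
    unfolding complexity_def fst_conv snd_conv using assms by simp
qed

text \<open>Among the arcs covering a nested dotted arc \<open>{b, c}\<close> an innermost one
  \<open>{a, d}\<close> is chosen. Then no arc joins the gap between \<open>a\<close> and
  \<open>b\<close> to the gap between \<open>c\<close> and \<open>d\<close>, which is the only way
  in which \<open>{a, b}\<close> and \<open>{c, d}\<close> could meet a crossing that was not there
  before.\<close>

lemma exchange_exists:
  assumes z: "z \<in> diagrams n" and "\<not> standard z"
  obtains a b c d N E where "exchange n a b c d N E"
    "z = (N \<union> {{a, d}, {b, c}}, E \<union> {{b, c}}) \<or> z = (N \<union> {{a, d}, {b, c}}, E \<union> {{a, d}, {b, c}})"
proof -
  define M where "M = fst z"
  obtain b c where bc: "b < c" "{b, c} \<in> snd z" and "\<exists>a d. a < b \<and> c < d \<and> {a, d} \<in> M"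
    using assms(2) unfolding standard_def M_def by blast
  define P where "P a \<longleftrightarrow> a < b \<and> (\<exists>d>c. {a, d} \<in> M)" for a
  \<comment> \<open>For noncrossing arcs over \<open>{b, c}\<close>, the greatest left end belongs
    to the innermost; the bound \<open>b\<close> ensures that the maximum exists.\<close>
  define a where "a = (GREATEST a. P a)"
  have "\<exists>a. P a"
    using \<open>\<exists>a d. a < b \<and> c < d \<and> {a, d} \<in> M\<close> by (auto simp: P_def)
  then have "P a" and max: "\<And>a'. P a' \<Longrightarrow> a' \<le> a"
    unfolding a_def using GreatestI_ex_nat[of P b] Greatest_le_nat[of P _ b] by (auto simp: P_def)
  then obtain d where ad: "a < b" "c < d" "{a, d} \<in> M"
    by (auto simp: P_def)
  have pm: "perfect_matching {1..2*n} M"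
    using diagram_matching[OF z] by (simp add: M_def)
  have bc': "{b, c} \<in> M"
    using diagram_dotted_arc[OF z bc(2)] by (simp add: M_def)
  define N where "N = M - {{a, d}, {b, c}}"
  define E where "E = snd z - {{a, d}, {b, c}}"
  have M_eq: "M = N \<union> {{a, d}, {b, c}}"
    using bc' ad by (auto simp: N_def)
  have away: "a \<notin> A" "b \<notin> A" "c \<notin> A" "d \<notin> A" if "A \<in> N" for A
    using that matching_arc_eq[OF pm _ ad(3), of A] matching_arc_eq[OF pm _ bc', of A]
    by (auto simp: N_def)
  have cross: False if "{p, r} \<in> M" "{q, s} \<in> M" "p < q" "q < r" "r < s" for p q r s
    using diagram_noncrossing[OF z] that unfolding M_def by blast
  have no_between: False if "{p, q} \<in> N" "a < p" "p < b" "c < q" for p q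
    using max[of p] that by (auto simp: P_def N_def)
  have cross_arc: False if "{p, q} \<in> N" "a < p" "p < b" and outside: "q < a \<or> b < q" for p q
  proof -
    have M: "{p, q} \<in> M" "{q, p} \<in> M"
      using that(1) by (auto simp: N_def insert_commute)
    have "q \<noteq> c"
      using away[OF that(1)] by auto
    then consider "q < a" | "b < q" "q < c" | "c < q"
      using outside by linarith
    then show False
    proof cases
      case 1
      then show ?thesis
        using cross[OF M(2) ad(3)] ad bc that by simp
    next
      case 2
      then show ?thesis
        using cross[OF M(1) bc'] that by simp
    next
      case 3
      then show ?thesis
        using no_between[OF that(1-3)] by simp
    qed
  qed
  have cross_arc': False if "{p, q} \<in> N" "c < p" "p < d" and outside: "q < c \<or> d < q" for p q
  proof -
    have M: "{p, q} \<in> M" "{q, p} \<in> M"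
      using that(1) by (auto simp: N_def insert_commute)
    have "{q, p} \<in> N"
      using that(1) by (simp add: insert_commute)
    have "q \<noteq> a" "q \<noteq> b"
      using away[OF that(1)] by auto
    then consider "q < a" | "a < q" "q < b" | "b < q" "q < c" | "d < q"
      using outside by linarith
    then show False
    proof cases
      case 1
      then show ?thesis
        using cross[OF M(2) ad(3)] ad bc that by simp
    next
      case 2
      then show ?thesis
        using no_between[OF \<open>{q, p} \<in> N\<close>] that by simp
    next
      case 3
      then show ?thesis
        using cross[OF bc' M(2)] that by simp
    next
      case 4
      then show ?thesis
        using cross[OF ad(3) M(1)] that ad bc by simp
    qed
  qed
  have disj: "A \<inter> B = {}" if "A \<in> N" "B \<in> N" "A \<noteq> B" for A B
    using matching_arc_eq[OF pm, of A B] that by (auto simp: N_def)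
  have partition: "partition_on {1..2*n} (N \<union> {{a, b}, {c, d}})"
  proof (rule partition_onI)
    have "\<Union>(N \<union> {{a, b}, {c, d}}) = \<Union>M"
      unfolding M_eq by auto
    then show "\<Union>(N \<union> {{a, b}, {c, d}}) = {1..2*n}"
      using pm by (simp add: perfect_matching_def partition_on_def)
    show "disjnt A B" if "A \<in> N \<union> {{a, b}, {c, d}}" "B \<in> N \<union> {{a, b}, {c, d}}" "A \<noteq> B" for A B
      using that disj[of A B] away[of A] away[of B] ad bc by (auto simp: disjnt_def)
    have "partition_on {1..2*n} M"
      using pm unfolding perfect_matching_def by (rule conjunct1)
    then have "{} \<notin> M"
      by (rule partition_onD3)
    then show "{} \<notin> N \<union> {{a, b}, {c, d}}"
      by (simp add: N_def)
  qed
  have "card A = 2" if "A \<in> N" for A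
    using that pm unfolding perfect_matching_def N_def by blast
  then have card: "card A = 2" if "A \<in> N \<union> {{a, b}, {c, d}}" for A
    using that ad bc by auto
  have noncrossing: False
    if "p < q" "q < r" "r < s" "{p, r} \<in> N \<union> {{a, b}, {c, d}}" "{q, s} \<in> N \<union> {{a, b}, {c, d}}" for p q r s
  proof -
    have new: "{p, r} = {a, b} \<longleftrightarrow> p = a \<and> r = b" "{p, r} = {c, d} \<longleftrightarrow> p = c \<and> r = d"
      "{q, s} = {a, b} \<longleftrightarrow> q = a \<and> s = b" "{q, s} = {c, d} \<longleftrightarrow> q = c \<and> s = d"
      using that(1-3) ad bc by (auto simp: doubleton_eq_iff)
    have flip: "{r, p} = {p, r}" "{s, q} = {q, s}"
      by auto
    have Q: "{q, s} \<in> N \<or> (q = a \<and> s = b) \<or> (q = c \<and> s = d)"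
      using that(5) unfolding new[symmetric] by blast
    have "{p, r} \<in> N \<or> (p = a \<and> r = b) \<or> (p = c \<and> r = d)"
      using that(4) unfolding new[symmetric] by blast
    then show False
    proof (elim disjE conjE)
      assume pr: "{p, r} \<in> N"
      from Q show False
      proof (elim disjE conjE)
        assume "{q, s} \<in> N"
        then show False
          using cross[OF _ _ that(1-3)] pr by (simp add: N_def)
      next
        assume "q = a" "s = b"
        then show False
          using cross_arc[of r p] that(1-3) flip pr by simp
      next
        assume "q = c" "s = d"
        then show False
          using cross_arc'[of r p] that(1-3) flip pr by simp
      qed
    next
      assume pr: "p = a" "r = b"
      from Q show False
        using cross_arc[of q s] that(1-3) pr ad bc by (elim disjE) simp_all
    next
      assume pr: "p = c" "r = d"
      from Q show False
        using cross_arc'[of q s] that(1-3) pr ad bc by (elim disjE) simp_all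
    qed
  qed
  have "crossingless_matching n (N \<union> {{a, b}, {c, d}})"
    unfolding crossingless_matching_def
  proof (intro conjI ballI notI; (elim exE conjE)?)
    show "partition_on {1..2*n} (N \<union> {{a, b}, {c, d}})"
      by (rule partition)
  qed (rule card noncrossing; assumption)+
  moreover have "crossingless_matching n (N \<union> {{a, d}, {b, c}})"
    using z unfolding M_eq[symmetric] M_def by (auto simp: diagrams_def)
  moreover have "E \<subseteq> N"
    using diagram_dotted_arc[OF z] by (auto simp: E_def N_def M_def)
  ultimately have "exchange n a b c d N E"
    using ad bc by (simp add: exchange_def)
  \<comment> \<open>Whether the outer arc is dotted as well decides between the relations of type II
    and type I.\<close>
  moreover have "snd z = E \<union> {{b, c}} \<or> snd z = E \<union> {{a, d}, {b, c}}"
    using bc(2) by (auto simp: E_def)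
  then have "z = (N \<union> {{a, d}, {b, c}}, E \<union> {{b, c}}) \<or> z = (N \<union> {{a, d}, {b, c}}, E \<union> {{a, d}, {b, c}})"
    using M_eq by (auto simp: M_def prod_eq_iff)
  ultimately show thesis
    by (rule that)
qed

section \<open>Rewriting modulo the relations\<close>

definition reducible :: "nat \<Rightarrow> (diagram \<Rightarrow>\<^sub>0 int) \<Rightarrow> bool" where
  "reducible n f \<longleftrightarrow> (\<exists>g. Poly_Mapping.keys g \<subseteq> {z \<in> diagrams n. standard z} \<and> f - g \<in> skein_relations n)"

lemma reducible_relation: "f \<in> skein_relations n \<Longrightarrow> reducible n f"
  unfolding reducible_def by (rule exI[of _ 0]) simp

lemma reducible_diff:
  assumes "reducible n f" "reducible n g"
  shows "reducible n (f - g)"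
proof -
  obtain f' g' where *: "Poly_Mapping.keys f' \<subseteq> {z \<in> diagrams n. standard z}" "f - f' \<in> skein_relations n"
    "Poly_Mapping.keys g' \<subseteq> {z \<in> diagrams n. standard z}" "g - g' \<in> skein_relations n"
    using assms unfolding reducible_def by blast
  have "(f - g) - (f' - g') = (f - f') + - (g - g')"
    by simp
  then have "(f - g) - (f' - g') \<in> skein_relations n"
    using skein_relations_add[OF *(2) skein_relations_uminus[OF *(4)]] by (simp only:)
  moreover have "Poly_Mapping.keys (f' - g') \<subseteq> {z \<in> diagrams n. standard z}"
    using keys_diff[of f' g'] *(1,3) by blast
  ultimately show ?thesis
    unfolding reducible_def by blast
qed

lemma reducible_add:
  assumes "reducible n f" "reducible n g"
  shows "reducible n (f + g)"
  using reducible_diff[OF assms(1) reducible_diff[OF reducible_relation[OF skein_relations_0] assms(2)]] by simp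

text \<open>Induction on \<open>complexity\<close>: the relation found by
  \<open>exchange_exists\<close> is solved for \<open>z\<close>, and all its other diagrams are
  smaller.\<close>

lemma reducible_frag_of: "z \<in> diagrams n \<Longrightarrow> reducible n (frag_of z)"
proof (induction "complexity z" arbitrary: z rule: less_induct)
  case less
  show ?case
  proof (cases "standard z")
    case True
    then have "Poly_Mapping.keys (frag_of z) \<subseteq> {z \<in> diagrams n. standard z}"
      using less.prems by simp
    then show ?thesis
      unfolding reducible_def using skein_relations_0 by (intro exI[of _ "frag_of z"]) simp
  next
    case False
    obtain a b c d N E where ex: "exchange n a b c d N E"
      and z: "z = (N \<union> {{a, d}, {b, c}}, E \<union> {{b, c}}) \<or> z = (N \<union> {{a, d}, {b, c}}, E \<union> {{a, d}, {b, c}})"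
      using exchange_exists[OF less.prems False] .
    have lt: "a < b" "b < c" "c < d" and EN: "E \<subseteq> N"
      using ex by (auto simp: exchange_def)
    have "partition_on {1..2*n} (N \<union> {{a, d}, {b, c}})"
      using ex unfolding exchange_def crossingless_matching_def by blast
    then have "finite (N \<union> {{a, d}, {b, c}})"
      by (rule finite_elements[rotated]) simp
    then have fin: "finite N"
      by simp
    have neq: "{a, b} \<noteq> {c, d}" "{a, d} \<noteq> {b, c}"
      using lt by (auto simp: doubleton_eq_iff)
    \<comment> \<open>In terms of the three gaps, all comparisons of complexities become linear
      inequalities between positive numbers.\<close>
    define i j k where ijk: "i = b - a" "j = c - b" "k = d - c"
    have pos: "0 < i" "0 < j" "0 < k" and da: "d - a = i + j + k"
      using lt by (simp_all add: ijk)
    note notin = exchange_arcs_notin[OF ex]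
    have split: "complexity (N \<union> {{a, b}, {c, d}}, E \<union> Z) = complexity (N, E)
        + (if {a, b} \<in> Z then 1 else 2) * i + (if {c, d} \<in> Z then 1 else 2) * k"
      if "Z \<subseteq> {{a, b}, {c, d}}" for Z
      using complexity_add_arcs[OF fin EN that notin(1,2) neq(1) lt(1,3)] by (simp only: ijk)
    have nested: "complexity (N \<union> {{a, d}, {b, c}}, E \<union> Z) = complexity (N, E)
        + (if {a, d} \<in> Z then 1 else 2) * (i + j + k) + (if {b, c} \<in> Z then 1 else 2) * j"
      if "Z \<subseteq> {{a, d}, {b, c}}" for Z
      using complexity_add_arcs[OF fin EN that notin(3,4) neq(2) _ lt(2)] lt by (simp only: ijk(2)[symmetric] da)
    from z show ?thesis
    proof
      assume z: "z = (N \<union> {{a, d}, {b, c}}, E \<union> {{b, c}})"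
      let ?p = "(N \<union> {{a, b}, {c, d}}, E \<union> {{a, b}})"
      let ?q = "(N \<union> {{a, b}, {c, d}}, E \<union> {{c, d}})"
      let ?r = "(N \<union> {{a, d}, {b, c}}, E \<union> {{a, d}})"
      have "complexity ?p = complexity (N, E) + i + 2 * k"
        using split[of "{{a, b}}"] neq by simp
      moreover have "complexity ?q = complexity (N, E) + 2 * i + k"
        using split[of "{{c, d}}"] neq by simp
      moreover have "complexity ?r = complexity (N, E) + (i + j + k) + 2 * j"
        using nested[of "{{a, d}}"] neq by simp
      moreover have "complexity z = complexity (N, E) + 2 * (i + j + k) + j"
        using nested[of "{{b, c}}"] neq z by simp
      ultimately have smaller: "complexity ?p < complexity z" "complexity ?q < complexity z" "complexity ?r < complexity z"
        using pos by simp_all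
      have dia: "?p \<in> diagrams n" "?q \<in> diagrams n" "?r \<in> diagrams n"
        by (rule exchange_diagrams[OF ex], blast)+
      have "reducible n (frag_of ?p)" "reducible n (frag_of ?q)" "reducible n (frag_of ?r)"
        by (rule less.hyps[OF smaller(1) dia(1)] less.hyps[OF smaller(2) dia(2)] less.hyps[OF smaller(3) dia(3)])+
      moreover have "frag_of ?p + frag_of ?q - (frag_of ?r + frag_of z) \<in> type_I_relators n"
        using ex unfolding type_I_relators_def z by blast
      then have "frag_of ?p + frag_of ?q - (frag_of ?r + frag_of z) \<in> skein_relations n"
        unfolding skein_relations_def by (intro generate.incl) simp
      then have "reducible n (frag_of ?p + frag_of ?q - (frag_of ?r + frag_of z))"
        by (rule reducible_relation)
      \<comment> \<open>Subtracting the relator from \<open>?p\<close> + \<open>?q\<close> -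
        \<open>?r\<close> leaves exactly \<open>z\<close>.\<close>
      ultimately have "reducible n (frag_of ?p + frag_of ?q - frag_of ?r
          - (frag_of ?p + frag_of ?q - (frag_of ?r + frag_of z)))"
        by (rule reducible_diff[OF reducible_diff[OF reducible_add]])
      then show ?thesis
        by simp
    next
      assume z: "z = (N \<union> {{a, d}, {b, c}}, E \<union> {{a, d}, {b, c}})"
      let ?p = "(N \<union> {{a, b}, {c, d}}, E \<union> {{a, b}, {c, d}})"
      have "complexity ?p < complexity z"
        using split[OF order.refl] nested[OF order.refl] pos z by simp
      then have "reducible n (frag_of ?p)"
        by (rule less.hyps[OF _ exchange_diagrams(1)[OF ex order.refl]])
      moreover have "frag_of ?p - frag_of z \<in> type_II_relators n"
        using ex unfolding type_II_relators_def z by blast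
      then have "frag_of ?p - frag_of z \<in> skein_relations n"
        unfolding skein_relations_def by (intro generate.incl) simp
      then have "reducible n (frag_of ?p - frag_of z)"
        by (rule reducible_relation)
      ultimately have "reducible n (frag_of ?p - (frag_of ?p - frag_of z))"
        by (rule reducible_diff)
      then show ?thesis
        by simp
    qed
  qed
qed

lemma reducible:
  "Poly_Mapping.keys f \<subseteq> diagrams n \<Longrightarrow> reducible n f"
proof (induction f rule: frag_induction)
  case zero
  show ?case
    by (rule reducible_relation[OF skein_relations_0])
qed (simp_all add: reducible_frag_of reducible_diff)

subsection \<open>Independence of standard diagrams\<close>

text \<open>The leading monomial: every factor x_a + x_b contributes the variable with the larger
  index. Monomials are compared by the sum of their indices.\<close>

definition lead :: "diagram \<Rightarrow> nat set" where
  "lead z = Max ` (fst z - snd z)"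

lemma lead_memI: "{a, d} \<in> fst z - snd z \<Longrightarrow> a < d \<Longrightarrow> d \<in> lead z"
  unfolding lead_def by (rule image_eqI[of _ _ "{a, d}"]) auto

lemma lead_memE:
  assumes "z \<in> diagrams n" "d \<in> lead z"
  obtains a where "a < d" "{a, d} \<in> fst z - snd z"
proof -
  obtain A where A: "A \<in> fst z - snd z" "d = Max A"
    using assms(2) by (auto simp: lead_def)
  obtain u v where uv: "A = {u, v}" "u < v"
    using matching_arc_lessE[OF diagram_matching[OF assms(1)]] A(1) by blast
  then have "d = v"
    using A(2) by simp
  then show thesis
    using that[of u] uv A(1) by blast
qed

lemma lead_inter_arc:
  assumes "z \<in> diagrams n" "A \<in> fst z"
  shows "lead z \<inter> A = (if A \<in> snd z then {} else {Max A})"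
proof -
  have pm: "perfect_matching {1..2*n} (fst z)"
    by (rule diagram_matching[OF assms(1)])
  have Max_in: "Max B \<in> B" if "B \<in> fst z" for B
    using matching_arcE[OF pm that] by (metis Max_in finite.emptyI finite_insert insert_not_empty)
  have "B = A" if "B \<in> fst z" "Max B \<in> A" for B
    using matching_arc_eq[OF pm that(1) assms(2) Max_in[OF that(1)] that(2)] .
  then show ?thesis
    using assms(2) Max_in[OF assms(2)] by (auto simp: lead_def)
qed

lemma lead_subset:
  assumes "z \<in> diagrams n"
  shows "lead z \<subseteq> {1..2*n}"
proof
  fix d assume "d \<in> lead z"
  then obtain a where "{a, d} \<in> fst z"
    using lead_memE[OF assms] by blast
  then show "d \<in> {1..2*n}"
    using diagram_arc_subset[OF assms] by blast
qed

text \<open>The set of the right ends of the undotted arcs is the largest transversal of a diagram, which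
  makes the coefficients of standard diagrams triangular.\<close>

lemma transversal_sum_le:
  assumes z: "z \<in> diagrams n" and S: "S \<subseteq> {1..2*n}" "transversal z S"
  shows "\<Sum>S \<le> \<Sum>(lead z)" "\<Sum>S = \<Sum>(lead z) \<Longrightarrow> S = lead z"
proof -
  have pm: "perfect_matching {1..2*n} (fst z)"
    by (rule diagram_matching[OF z])
  have lead_sub: "lead z \<subseteq> {1..2*n}"
    by (rule lead_subset[OF z])
  have Union: "\<Union>(fst z) = {1..2*n}"
    using pm by (simp add: perfect_matching_def partition_on_def)
  have fin: "finite (fst z)"
    using finite_elements[of "{1..2*n}" "fst z"] pm by (simp add: perfect_matching_def)
  have decomp: "T = (\<Union>A\<in>fst z. T \<inter> A)" "\<Sum>T = (\<Sum>A\<in>fst z. \<Sum>(T \<inter> A))" if "T \<subseteq> {1..2*n}" for T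
  proof -
    show eq: "T = (\<Union>A\<in>fst z. T \<inter> A)"
      using that Union by blast
    have "\<Sum>(\<Union>A\<in>fst z. T \<inter> A) = (\<Sum>A\<in>fst z. \<Sum>(T \<inter> A))"
    proof (rule sum.UNION_disjoint[OF fin])
      show "\<forall>A\<in>fst z. finite (T \<inter> A)"
        using finite_subset[OF that] by auto
      show "\<forall>A\<in>fst z. \<forall>B\<in>fst z. A \<noteq> B \<longrightarrow> (T \<inter> A) \<inter> (T \<inter> B) = {}"
        using matching_arc_eq[OF pm] by blast
    qed
    then show "\<Sum>T = (\<Sum>A\<in>fst z. \<Sum>(T \<inter> A))"
      unfolding eq[symmetric] .
  qed
  have arc: "\<Sum>(S \<inter> A) \<le> \<Sum>(lead z \<inter> A) \<and> (\<Sum>(S \<inter> A) = \<Sum>(lead z \<inter> A) \<longrightarrow> S \<inter> A = lead z \<inter> A)"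
    if A: "A \<in> fst z" for A
  proof (cases "A \<in> snd z")
    case True
    then have "card (S \<inter> A) = 0"
      using S(2) A by (simp add: transversal_def)
    then have "S \<inter> A = {}"
      using finite_subset[OF S(1)] by simp
    then show ?thesis
      using True lead_inter_arc[OF z A] by simp
  next
    case False
    then have "card (S \<inter> A) = 1"
      using S(2) A by (simp add: transversal_def)
    then obtain x where x: "S \<inter> A = {x}"
      by (auto simp: card_1_singleton_iff)
    have "finite A"
      using matching_arcE[OF pm A] by (metis finite.emptyI finite_insert)
    moreover have "x \<in> A"
      using x by blast
    ultimately have "x \<le> Max A"
      by simp
    then show ?thesis
      using x False lead_inter_arc[OF z A] by simp
  qed
  show "\<Sum>S \<le> \<Sum>(lead z)"
    unfolding decomp(2)[OF S(1)] decomp(2)[OF lead_sub] using arc by (intro sum_mono) blast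
  assume "\<Sum>S = \<Sum>(lead z)"
  then have "(\<Sum>A\<in>fst z. \<Sum>(S \<inter> A)) = (\<Sum>A\<in>fst z. \<Sum>(lead z \<inter> A))"
    unfolding decomp(2)[OF S(1)] decomp(2)[OF lead_sub] .
  \<comment> \<open>The inequality holds arc by arc, so equality of the totals forces equality on
    every arc.\<close>
  then have "S \<inter> A = lead z \<inter> A" if "A \<in> fst z" for A
    using sum_mono_inv[of "\<lambda>A. \<Sum>(S \<inter> A)" "fst z" "\<lambda>A. \<Sum>(lead z \<inter> A)" A] arc that fin by blast
  then have "(\<Union>A\<in>fst z. S \<inter> A) = (\<Union>A\<in>fst z. lead z \<inter> A)"
    by blast
  then show "S = lead z"
    unfolding decomp(1)[OF S(1), symmetric] decomp(1)[OF lead_sub, symmetric] .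
qed

lemma lead_transversal:
  assumes "z \<in> diagrams n"
  shows "transversal z (lead z)"
  using lead_inter_arc[OF assms] by (auto simp: transversal_def)

text \<open>In a standard diagram the left end of an undotted arc is the nearest point to the left of its
  right end that is neither a right end of an undotted arc nor matched with an earlier one.\<close>

lemma undotted_mate_nearest:
  assumes y: "y \<in> diagrams n" "standard y" and z: "z \<in> diagrams n" and lead: "lead y = lead z"
    and earlier: "\<And>p q. q < d \<Longrightarrow> p < q \<Longrightarrow> {p, q} \<in> fst y - snd y \<Longrightarrow> {p, q} \<in> fst z"
    and ad: "{a, d} \<in> fst y - snd y" and bd: "{b, d} \<in> fst z - snd z" and lt: "a < b" "b < d"
  shows False
proof -
  have b_lead: "b \<notin> lead z"
  proof
    assume "b \<in> lead z"
    then obtain e where "e < b" "{e, b} \<in> fst z"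
      using lead_memE[OF z] by blast
    then show False
      using diagram_mate_unique[OF z, of b e d] bd lt by (auto simp: insert_commute)
  qed
  have "b \<in> {1..2*n}"
    using bd diagram_arc_subset[OF z] by blast
  then obtain e where e: "{b, e} \<in> fst y"
    using matching_mate_ex[OF diagram_matching[OF y(1)]] by blast
  have "e \<noteq> b"
    using matching_pair_neq[OF diagram_matching[OF y(1)] e] by simp
  moreover have "e \<noteq> a" "e \<noteq> d"
    using diagram_mate_unique[OF y(1), of a b d] diagram_mate_unique[OF y(1), of d b a] e ad lt
    by (auto simp: insert_commute)
  moreover have "\<not> e < a"
    using diagram_noncrossing[OF y(1), of e b a d] e ad lt by (auto simp: insert_commute)
  moreover have "\<not> d < e"
    using diagram_noncrossing[OF y(1), of a d b e] e ad lt by auto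
  \<comment> \<open>Noncrossing traps the mate \<open>e\<close> of \<open>b\<close> in
    \<open>y\<close> under \<open>{a, d}\<close>, and standardness makes that arc undotted. If
    \<open>e < b\<close>, then \<open>b\<close> would be in \<open>lead y\<close>; if
    \<open>b < e\<close>, the arc is an earlier one and hence also in \<open>z\<close>, where
    \<open>b\<close> is matched with \<open>d\<close>.\<close>
  ultimately consider "a < e" "e < b" | "b < e" "e < d"
    by linarith
  then show False
  proof cases
    case 1
    then have "{e, b} \<notin> snd y"
      using y(2) ad lt unfolding standard_def by blast
    then have "b \<in> lead y"
      using lead_memI[of e b y] e 1 by (simp add: insert_commute)
    then show False
      using b_lead lead by simp
  next
    case 2
    then have "{b, e} \<notin> snd y"
      using y(2) ad lt unfolding standard_def by blast
    then have "{b, e} \<in> fst z"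
      using earlier[of e b] e 2 by blast
    then show False
      using diagram_mate_unique[OF z, of b e d] bd 2 by auto
  qed
qed

text \<open>Induction on the right end \<open>d\<close>. Equal leads provide an undotted arc ending
  at \<open>d\<close> in both diagrams or in neither, and if the left ends differed, the one farther
  from \<open>d\<close> would contradict \<open>undotted_mate_nearest\<close>.\<close>

lemma undotted_arcs_eq:
  assumes y: "y \<in> diagrams n" "standard y" and z: "z \<in> diagrams n" "standard z" and lead: "lead y = lead z"
  shows "fst y - snd y = fst z - snd z"
proof -
  have pairs: "\<forall>a<d. {a, d} \<in> fst y - snd y \<longleftrightarrow> {a, d} \<in> fst z - snd z" for d
  proof (induction d rule: less_induct)
    case (less d)
    have eq: "a = b" if "{a, d} \<in> fst y - snd y" "{b, d} \<in> fst z - snd z" "a < d" "b < d" for a b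
    proof (rule linorder_cases[of a b])
      assume "a < b"
      then show ?thesis
        using undotted_mate_nearest[OF y z(1) lead _ that(1,2)] less.IH that(4) by blast
    next
      assume "b < a"
      then show ?thesis
        using undotted_mate_nearest[OF z y(1) lead[symmetric] _ that(2,1)] less.IH that(3) by blast
    qed
    show ?case
    proof (intro allI impI iffI)
      fix a assume a: "a < d" "{a, d} \<in> fst y - snd y"
      then obtain b where "b < d" "{b, d} \<in> fst z - snd z"
        using lead_memI[OF a(2,1)] lead lead_memE[OF z(1), of d] by auto
      then show "{a, d} \<in> fst z - snd z"
        using eq[of a b] a by blast
    next
      fix a assume a: "a < d" "{a, d} \<in> fst z - snd z"
      then obtain b where "b < d" "{b, d} \<in> fst y - snd y"
        using lead_memI[OF a(2,1)] lead lead_memE[OF y(1), of d] by auto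
      then show "{a, d} \<in> fst y - snd y"
        using eq[of b a] a by blast
    qed
  qed
  show ?thesis
  proof (rule Set.set_eqI)
    fix A
    show "A \<in> fst y - snd y \<longleftrightarrow> A \<in> fst z - snd z"
      using pairs matching_arc_lessE[OF diagram_matching[OF y(1)], of A]
        matching_arc_lessE[OF diagram_matching[OF z(1)], of A]
      by (metis Diff_iff)
  qed
qed

text \<open>A dotted arc with an end under \<open>{u, w}\<close> would cross it or be nested in it.
  Hence the dotted arcs of a standard diagram join neighbours in the set of dotted ends.\<close>

lemma standard_dotted_gap:
  assumes y: "y \<in> diagrams n" "standard y" and "{u, w} \<in> snd y" "u < v" "v < w"
  shows "v \<notin> \<Union>(snd y)"
proof
  assume "v \<in> \<Union>(snd y)"
  then obtain B where B: "B \<in> snd y" "v \<in> B"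
    by blast
  obtain s t where "B = {s, t}"
    using matching_arcE[OF diagram_matching[OF y(1)] diagram_dotted_arc[OF y(1) B(1)]] by metis
  then obtain t where vt: "{v, t} \<in> snd y"
    using B by (auto simp: insert_commute)
  have M: "{u, w} \<in> fst y" "{v, t} \<in> fst y"
    using diagram_dotted_arc[OF y(1)] assms(3) vt by blast+
  have "t \<noteq> v"
    using matching_pair_neq[OF diagram_matching[OF y(1)] M(2)] by simp
  moreover have "t \<noteq> u" "t \<noteq> w"
    using diagram_mate_unique[OF y(1), of u w v] diagram_mate_unique[OF y(1), of w u v] M assms(4,5)
    by (auto simp: insert_commute)
  moreover have "\<not> t < u"
    using diagram_noncrossing[OF y(1), of t v u w] M assms(4,5) by (auto simp: insert_commute)
  moreover have "\<not> w < t"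
    using diagram_noncrossing[OF y(1), of u w v t] M assms(4,5) by auto
  ultimately consider "u < t" "t < v" | "v < t" "t < w"
    by linarith
  then show False
  proof cases
    case 1
    then have "{t, v} \<notin> snd y"
      using y(2) M(1) assms(5) unfolding standard_def by blast
    then show False
      using vt by (simp add: insert_commute)
  next
    case 2
    then show False
      using y(2) M(1) assms(4) vt unfolding standard_def by blast
  qed
qed

text \<open>The mate of \<open>u\<close> in \<open>z\<close> is not to its left, since that arc
  would already be shared with \<open>y\<close>. It is therefore the next dotted end to the right,
  as \<open>w\<close> is in \<open>y\<close>.\<close>

lemma dotted_arc_transfer:
  assumes y: "y \<in> diagrams n" "standard y" and z: "z \<in> diagrams n" "standard z"
    and ends: "\<Union>(snd y) = \<Union>(snd z)"
    and earlier: "\<And>p q. p < u \<Longrightarrow> p < q \<Longrightarrow> {p, q} \<in> snd z \<Longrightarrow> {p, q} \<in> snd y"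
    and uw: "{u, w} \<in> snd y" "u < w"
  shows "{u, w} \<in> snd z"
proof -
  have "u \<in> \<Union>(snd z)" "w \<in> \<Union>(snd z)"
    using uw ends by blast+
  then obtain B where B: "B \<in> snd z" "u \<in> B"
    by blast
  obtain s t where "B = {s, t}"
    using matching_arcE[OF diagram_matching[OF z(1)] diagram_dotted_arc[OF z(1) B(1)]] by metis
  then obtain v where uv: "{u, v} \<in> snd z"
    using B by (auto simp: insert_commute)
  have "v \<noteq> u"
    using matching_pair_neq[OF diagram_matching[OF z(1)] diagram_dotted_arc[OF z(1) uv]] by simp
  moreover have "\<not> v < u"
  proof
    assume "v < u"
    then have "{u, v} \<in> snd y"
      using earlier[of v u] uv by (simp add: insert_commute)
    then have "v = w"
      using diagram_mate_unique[OF y(1)] diagram_dotted_arc[OF y(1)] uw(1) by blast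
    then show False
      using \<open>v < u\<close> uw(2) by simp
  qed
  moreover have "v \<in> \<Union>(snd y)"
    using uv ends by blast
  \<comment> \<open>If the mates differed, the nearer one would be a dotted end strictly under the
    arc to the farther one.\<close>
  then have "\<not> (u < v \<and> v < w)"
    using standard_dotted_gap[OF y uw(1)] by blast
  moreover have "\<not> (u < w \<and> w < v)"
    using standard_dotted_gap[OF z uv] \<open>w \<in> \<Union>(snd z)\<close> by blast
  ultimately have "v = w"
    using uw(2) by linarith
  then show ?thesis
    using uv by simp
qed

lemma dotted_arcs_eq:
  assumes y: "y \<in> diagrams n" "standard y" and z: "z \<in> diagrams n" "standard z"
    and ends: "\<Union>(snd y) = \<Union>(snd z)"
  shows "snd y = snd z"
proof -
  have pairs: "\<forall>w>u. {u, w} \<in> snd y \<longleftrightarrow> {u, w} \<in> snd z" for u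
  proof (induction u rule: less_induct)
    case (less u)
    have earlier: "{p, q} \<in> snd y \<longleftrightarrow> {p, q} \<in> snd z" if "p < u" "p < q" for p q
      using less.IH that by blast
    show ?case
    proof (intro allI impI iffI)
      fix w assume "u < w" "{u, w} \<in> snd y"
      then show "{u, w} \<in> snd z"
        using dotted_arc_transfer[OF y z ends] earlier by blast
    next
      fix w assume "u < w" "{u, w} \<in> snd z"
      then show "{u, w} \<in> snd y"
        using dotted_arc_transfer[OF z y ends[symmetric]] earlier by blast
    qed
  qed
  show ?thesis
  proof (rule Set.set_eqI)
    fix A
    show "A \<in> snd y \<longleftrightarrow> A \<in> snd z"
      using pairs matching_arc_lessE[OF diagram_matching[OF y(1)], of A] diagram_dotted_arc[OF y(1), of A]
        matching_arc_lessE[OF diagram_matching[OF z(1)], of A] diagram_dotted_arc[OF z(1), of A]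
      by metis
  qed
qed

lemma diagram_dotted_ends:
  assumes "z \<in> diagrams n"
  shows "\<Union>(snd z) = {1..2*n} - \<Union>(fst z - snd z)"
proof -
  have pm: "perfect_matching {1..2*n} (fst z)"
    by (rule diagram_matching[OF assms])
  have "\<Union>(fst z) = {1..2*n}"
    using pm by (simp add: perfect_matching_def partition_on_def)
  moreover have "A = B" if "A \<in> snd z" "B \<in> fst z" "x \<in> A" "x \<in> B" for A B x
    using matching_arc_eq[OF pm diagram_dotted_arc[OF assms that(1)] that(2-4)] .
  moreover have "snd z \<subseteq> fst z"
    using diagram_dotted_arc[OF assms] by blast
  ultimately show ?thesis
    by blast
qed

text \<open>The lead determines the undotted arcs; the points left over are the dotted ends, and
  these determine the dotted arcs.\<close>

lemma lead_inj:
  assumes y: "y \<in> diagrams n" "standard y" and z: "z \<in> diagrams n" "standard z" and "lead y = lead z"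
  shows "y = z"
proof -
  have undotted: "fst y - snd y = fst z - snd z"
    by (rule undotted_arcs_eq[OF assms])
  then have dotted: "snd y = snd z"
    by (intro dotted_arcs_eq[OF y z]) (simp only: diagram_dotted_ends[OF y(1)] diagram_dotted_ends[OF z(1)])
  have "snd y \<subseteq> fst y" "snd z \<subseteq> fst z"
    using diagram_dotted_arc[OF y(1)] diagram_dotted_arc[OF z(1)] by blast+
  then have "fst y = fst z"
    using undotted dotted by blast
  then show ?thesis
    using dotted by (simp add: prod_eq_iff)
qed

text \<open>Triangularity: at the lead of a key \<open>z\<close> with maximal index sum only
  \<open>z\<close> itself contributes, so the coefficient there is that of \<open>z\<close> in
  \<open>g\<close>, which is nonzero.\<close>

lemma standard_independent:
  assumes keys: "Poly_Mapping.keys g \<subseteq> {z \<in> diagrams n. standard z}"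
    and zero: "\<And>S. S \<subseteq> {1..2*n} \<Longrightarrow> coeff n g S = 0"
  shows "g = 0"
proof (rule ccontr)
  assume "g \<noteq> 0"
  let ?W = "(\<lambda>z. \<Sum>(lead z)) ` Poly_Mapping.keys g"
  have W: "finite ?W" "?W \<noteq> {}"
    using \<open>g \<noteq> 0\<close> by simp_all
  obtain z where z: "z \<in> Poly_Mapping.keys g" and Max_W: "Max ?W = \<Sum>(lead z)"
    using Max_in[OF W] by (rule imageE)
  have max: "\<Sum>(lead y) \<le> \<Sum>(lead z)" if "y \<in> Poly_Mapping.keys g" for y
    unfolding Max_W[symmetric] by (rule Max_ge[OF W(1) imageI[OF that]])
  have dz: "z \<in> diagrams n" "standard z"
    using z keys by auto
  have "Poly_Mapping.lookup g y * of_bool (transversal y (lead z)) = (if y = z then Poly_Mapping.lookup g z else 0)"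
    if "y \<in> diagrams n" for y
  proof (cases "y \<in> Poly_Mapping.keys g \<and> transversal y (lead z)")
    case True
    then have "standard y"
      using keys by blast
    \<comment> \<open>One inequality holds because \<open>lead z\<close> is a transversal of
      \<open>y\<close>, the other by maximality of \<open>z\<close>.\<close>
    have "\<Sum>(lead z) = \<Sum>(lead y)"
      by (rule order.antisym[OF transversal_sum_le(1)[OF that lead_subset[OF dz(1)] conjunct2[OF True]]
          max[OF conjunct1[OF True]]])
    then have "lead z = lead y"
      by (rule transversal_sum_le(2)[OF that lead_subset[OF dz(1)] conjunct2[OF True]])
    then have "y = z"
      by (intro lead_inj[OF that \<open>standard y\<close> dz]) (rule sym)
    then show ?thesis
      using True by simp
  next
    case False
    then have "y \<noteq> z" "Poly_Mapping.lookup g y * of_bool (transversal y (lead z)) = 0"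
      using z lead_transversal[OF dz(1)] by (auto simp: in_keys_iff)
    then show ?thesis
      by simp
  qed
  then have "coeff n g (lead z) = (\<Sum>y\<in>diagrams n. if y = z then Poly_Mapping.lookup g z else 0)"
    unfolding coeff_def by (intro sum.cong refl)
  also have "\<dots> = Poly_Mapping.lookup g z"
    using dz(1) by (simp add: finite_diagrams)
  finally have "Poly_Mapping.lookup g z = 0"
    unfolding zero[OF lead_subset[OF dz(1)]] by (rule sym)
  then show False
    using z unfolding in_keys_iff by contradiction
qed

text \<open>The standard remainder of \<open>f\<close> has the same coefficients as
  \<open>f\<close>, all of them 0, so it vanishes by independence. Thus the relations exhaust the
  kernel of the map to polynomials.\<close>

lemma skein_relations_eq_kernel:
  assumes keys: "Poly_Mapping.keys f \<subseteq> diagrams n"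
    and zero: "\<And>S. S \<subseteq> {1..2*n} \<Longrightarrow> coeff n f S = 0"
  shows "f \<in> skein_relations n"
proof -
  obtain g where g: "Poly_Mapping.keys g \<subseteq> {z \<in> diagrams n. standard z}" "f - g \<in> skein_relations n"
    using reducible[OF keys] unfolding reducible_def by blast
  have "coeff n g S = 0" if "S \<subseteq> {1..2*n}" for S
    using coeff_skein_relations[OF g(2), of S] zero[OF that] by simp
  then have "g = 0"
    by (rule standard_independent[OF g(1)])
  then show ?thesis
    using g(2) by simp
qed

subsection \<open>The form on the skein module\<close>

lemma carrier_russell_skein_module:
  "x \<in> carrier (russell_skein_module n) \<longleftrightarrow> (\<exists>f. Poly_Mapping.keys f \<subseteq> diagrams n \<and> x = skein_class n f)"
  by (auto simp: russell_skein_module_def FactGroup_def RCOSETS_def skein_class_def) blast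

text \<open>Orthogonality to single diagrams makes all coefficients vanish, so \<open>f\<close> is a
  relation and its coset is the subgroup itself, the identity of the quotient.\<close>

lemma skein_class_eq_one:
  assumes "Poly_Mapping.keys f \<subseteq> diagrams n"
    and "\<And>a. a \<in> diagrams n \<Longrightarrow> free_form n f (frag_of a) = 0"
  shows "skein_class n f = \<one>\<^bsub>russell_skein_module n\<^esub>"
proof -
  have "f \<in> skein_relations n"
    using skein_relations_eq_kernel[OF assms(1)] coeff_eq_0_if_radical[OF assms] by blast
  then have "skein_class n f = skein_relations n"
    unfolding skein_class_def using assms(1) subgroup_skein_relations
    by (intro group.coset_join2 group_free_Abelian_group) simp_all
  then show ?thesis
    by (simp add: russell_skein_module_def FactGroup_def)
qed

theorem lemma3p1p1:
  fixes n :: nat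
  shows "(\<forall>f\<in>carrier (free_Abelian_group (diagrams n)). \<forall>g\<in>carrier (free_Abelian_group (diagrams n)).
            skein_form n (skein_class n f) (skein_class n g) = free_form n f g)
       \<and> nondegenerate_form_on (russell_skein_module n) (skein_form n)
       \<and> symmetric_form_on (russell_skein_module n) (skein_form n)"
proof (intro conjI)
  show "\<forall>f\<in>carrier (free_Abelian_group (diagrams n)). \<forall>g\<in>carrier (free_Abelian_group (diagrams n)).
      skein_form n (skein_class n f) (skein_class n g) = free_form n f g"
    by (simp add: skein_form_class)
  \<comment> \<open>Both radicals are treated together: symmetry of \<open>free_form\<close> turns
    vanishing on either side into vanishing against every diagram on the right.\<close>
  have "x = \<one>\<^bsub>russell_skein_module n\<^esub>"
    if x: "x \<in> carrier (russell_skein_module n)"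
      and zero: "(\<forall>y\<in>carrier (russell_skein_module n). skein_form n x y = 0)
        \<or> (\<forall>y\<in>carrier (russell_skein_module n). skein_form n y x = 0)" for x
  proof -
    obtain f where f: "Poly_Mapping.keys f \<subseteq> diagrams n" "x = skein_class n f"
      using x carrier_russell_skein_module by blast
    have "free_form n f (frag_of a) = 0" if "a \<in> diagrams n" for a
    proof -
      have a: "Poly_Mapping.keys (frag_of a) \<subseteq> diagrams n"
        using that by simp
      then have "skein_class n (frag_of a) \<in> carrier (russell_skein_module n)"
        using carrier_russell_skein_module by blast
      then have "free_form n f (frag_of a) = 0 \<or> free_form n (frag_of a) f = 0"
        using zero unfolding f(2) by (metis skein_form_class[OF f(1) a] skein_form_class[OF a f(1)])
      then show ?thesis
        using free_form_commute[OF f(1) a] by simp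
    qed
    then show ?thesis
      unfolding f(2) by (rule skein_class_eq_one[OF f(1)])
  qed
  then show "nondegenerate_form_on (russell_skein_module n) (skein_form n)"
    unfolding nondegenerate_form_on_def by blast
  show "symmetric_form_on (russell_skein_module n) (skein_form n)"
    unfolding symmetric_form_on_def
    using carrier_russell_skein_module skein_form_class free_form_commute by metis
qed

end
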